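(* Let $V_1,\dots,V_k$ be free abelian groups. For $m_1,\dots,m_k\ge0$ and a Lyndon word $u\in B(m_1,\dots,m_k)$, let $\beta_u:V_1^{\otimes m_1}\otimes\dots\otimes V_k^{\otimes m_k}\to\mathrm{Lie}[V_1\oplus\dots\oplus V_k]$ be the homomorphism sending $\bigotimes_{i=1}^k\bigotimes_{j=1}^{m_i}v_i^j$ to the element obtained from the bracketed monomial $\phi(u)$ by replacing, for each $i$, the $j$-th occurrence (from the left) of the letter $c_i$ by $v_i^j$, and let $\tilde\beta_u:\mathrm{Lie}[V_1^{\otimes m_1}\otimes\dots\otimes V_k^{\otimes m_k}]\to\mathrm{Lie}[V_1\oplus\dots\oplus V_k]$ be its extension to a Lie algebra map. Then $$\bigoplus\tilde\beta_u:\bigoplus_{\substack{m_1,\dots,m_k\ge0\\ u\in B(m_1,\dots,m_k)}}\mathrm{Lie}[V_1^{\otimes m_1}\otimes\dots\otimes V_k^{\otimes m_k}]\to\mathrm{Lie}[V_1\oplus\dots\oplus V_k]$$ is an isomorphism of abelian groups.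
   Context: A Lie algebra over $\mathbb{Z}$ is an abelian group with a bilinear bracket satisfying $[u,v]=-[v,u]$ and the Jacobi identity $[u,[v,w]]+[w,[u,v]]+[v,[w,u]]=0$ (the identity $[u,u]=0$ is not imposed); $\mathrm{Lie}[V]$ is the free such Lie algebra on an abelian group $V$. $B(m_1,\dots,m_k)$ is the set of Lyndon words in letters $c_1<\dots<c_k$ with $m_i$ occurrences of $c_i$: words strictly smaller in lexicographic order than all their proper cyclic rotations. A Lyndon word $w$ of length $>1$ has a standard factorisation $w=uv$ with $u<v$ Lyndon and $u$ as long as possible; $\phi(c_i)=c_i$ and $\phi(w)=[\phi(u),\phi(v)]$ for the standard factorisation defines a bracketed monomial $\phi(w)$. *)

theory Defs
  imports Main "HOL-Library.Poly_Mapping"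
begin

text \<open>Letters c_1 < ... < c_k are encoded as the natural numbers 0 < ... < k-1.
  Words are nat lists, compared by the usual lexicographic order lexordp
  (a proper prefix is smaller).\<close>

definition lyndon :: "nat list \<Rightarrow> bool" where
  "lyndon w \<longleftrightarrow> w \<noteq> [] \<and> (\<forall>j. 0 < j \<and> j < length w \<longrightarrow> ord_class.lexordp w (rotate j w))"

definition lyndon_B :: "nat list \<Rightarrow> nat list set" where
  "lyndon_B m = {w. set w \<subseteq> {..<length m} \<and>
                    (\<forall>i<length m. count_list w i = m ! i) \<and> lyndon w}"

definition std_split :: "nat list \<Rightarrow> nat" where
  "std_split w = (GREATEST n. 0 < n \<and> n < length w \<and> lyndon (take n w) \<and>
                      lyndon (drop n w) \<and> ord_class.lexordp (take n w) (drop n w))"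

datatype 'g mtree = Leaf 'g | Br "'g mtree" "'g mtree"

text \<open>The bracketed monomial phi(w), with each leaf labelled by the position
  (0-based, plus offset) of the corresponding letter in w.\<close>
function phi_pos :: "nat \<Rightarrow> nat list \<Rightarrow> nat mtree" where
  "phi_pos off w =
     (let n = std_split w in
      if length w \<le> 1 \<or> \<not> (0 < n \<and> n < length w) then Leaf off
      else Br (phi_pos off (take n w)) (phi_pos (off + n) (drop n w)))"
  by pat_completeness auto
termination
  by (relation "measure (\<lambda>(off, w). length w)") (auto simp: Let_def)

text \<open>Number of occurrences of the letter at position p among the earlier positions
  (i.e. the 0-based index j of that occurrence from the left).\<close>
definition occ :: "nat list \<Rightarrow> nat \<Rightarrow> nat" where
  "occ u p = count_list (take p u) (u ! p)"

text \<open>The free abelian group on a set S of generators inside the type 'b is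
  the set of finitely supported integer functions supported on S.\<close>
definition FA :: "'b set \<Rightarrow> ('b \<Rightarrow>\<^sub>0 int) set" where
  "FA S = {x. Poly_Mapping.keys x \<subseteq> S}"

text \<open>The free non-associative ring on the free abelian group with basis S is the
  free abelian group on binary trees with leaves in S, with bilinear bracket:\<close>
definition trees :: "'g set \<Rightarrow> 'g mtree set" where
  "trees S = {t. set_mtree t \<subseteq> S}"

definition bracket :: "('g mtree \<Rightarrow>\<^sub>0 int) \<Rightarrow> ('g mtree \<Rightarrow>\<^sub>0 int) \<Rightarrow> ('g mtree \<Rightarrow>\<^sub>0 int)" where
  "bracket x y = (\<Sum>s\<in>Poly_Mapping.keys x. \<Sum>t\<in>Poly_Mapping.keys y. Poly_Mapping.single (Br s t) (Poly_Mapping.lookup x s * Poly_Mapping.lookup y t))"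

text \<open>The Lie ideal generated by antisymmetry and Jacobi (note: [u,u]=0 is NOT imposed).\<close>
inductive_set lie_ideal :: "'g set \<Rightarrow> ('g mtree \<Rightarrow>\<^sub>0 int) set" for S where
  antisym: "a \<in> FA (trees S) \<Longrightarrow> b \<in> FA (trees S) \<Longrightarrow> bracket a b + bracket b a \<in> lie_ideal S"
| jacobi: "a \<in> FA (trees S) \<Longrightarrow> b \<in> FA (trees S) \<Longrightarrow> c \<in> FA (trees S) \<Longrightarrow>
     bracket a (bracket b c) + bracket c (bracket a b) + bracket b (bracket c a) \<in> lie_ideal S"
| zero: "0 \<in> lie_ideal S"
| add: "x \<in> lie_ideal S \<Longrightarrow> y \<in> lie_ideal S \<Longrightarrow> x + y \<in> lie_ideal S"
| neg: "x \<in> lie_ideal S \<Longrightarrow> - x \<in> lie_ideal S"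
| brl: "x \<in> lie_ideal S \<Longrightarrow> a \<in> FA (trees S) \<Longrightarrow> bracket x a \<in> lie_ideal S"
| brr: "x \<in> lie_ideal S \<Longrightarrow> a \<in> FA (trees S) \<Longrightarrow> bracket a x \<in> lie_ideal S"

definition coset :: "('b \<Rightarrow>\<^sub>0 int) set \<Rightarrow> ('b \<Rightarrow>\<^sub>0 int) set \<Rightarrow> ('b \<Rightarrow>\<^sub>0 int) \<Rightarrow> ('b \<Rightarrow>\<^sub>0 int) set" where
  "coset A I x = {y \<in> A. y - x \<in> I}"

definition quot :: "('b \<Rightarrow>\<^sub>0 int) set \<Rightarrow> ('b \<Rightarrow>\<^sub>0 int) set \<Rightarrow> ('b \<Rightarrow>\<^sub>0 int) set set" where
  "quot A I = coset A I ` A"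

definition Lie :: "'g set \<Rightarrow> ('g mtree \<Rightarrow>\<^sub>0 int) set set" where
  "Lie S = quot (FA (trees S)) (lie_ideal S)"

definition lin_ext :: "('b \<Rightarrow> 'c) \<Rightarrow> ('b \<Rightarrow>\<^sub>0 int) \<Rightarrow> ('c \<Rightarrow>\<^sub>0 int)" where
  "lin_ext f x = (\<Sum>b\<in>Poly_Mapping.keys x. Poly_Mapping.single (f b) (Poly_Mapping.lookup x b))"

definition induced :: "('c \<Rightarrow>\<^sub>0 int) set \<Rightarrow> ('c \<Rightarrow>\<^sub>0 int) set \<Rightarrow>
     (('b \<Rightarrow>\<^sub>0 int) \<Rightarrow> ('c \<Rightarrow>\<^sub>0 int)) \<Rightarrow> ('b \<Rightarrow>\<^sub>0 int) set \<Rightarrow> ('c \<Rightarrow>\<^sub>0 int) set" where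
  "induced B J F C = coset B J (F (SOME x. x \<in> C))"

text \<open>V_i is the free abelian group on the basis X i (i < k).
  V_1 (+) ... (+) V_k is free on the tagged basis {(i,x). i<k, x \<in> X i}.\<close>
definition sum_basis :: "nat \<Rightarrow> (nat \<Rightarrow> 'a set) \<Rightarrow> (nat \<times> 'a) set" where
  "sum_basis k X = {(i, x). i < k \<and> x \<in> X i}"

text \<open>V_1^(m_1) (x) ... (x) V_k^(m_k) is free on the tuples of basis elements:
  ls ! i ! j is the basis element in the j-th tensor factor of V_i^(m_i).\<close>
definition tensor_basis :: "nat \<Rightarrow> (nat \<Rightarrow> 'a set) \<Rightarrow> nat list \<Rightarrow> 'a list list set" where
  "tensor_basis k X m = {ls. length ls = k \<and>
      (\<forall>i<k. length (ls ! i) = m ! i \<and> set (ls ! i) \<subseteq> X i)}"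

definition beta_tree :: "nat list \<Rightarrow> 'a list list \<Rightarrow> (nat \<times> 'a) mtree" where
  "beta_tree u ls = map_mtree (\<lambda>p. (u ! p, ls ! (u ! p) ! occ u p)) (phi_pos 0 u)"

text \<open>Substitution of trees for leaves (the Lie/magma map extending a map on generators).\<close>
primrec graft :: "('g \<Rightarrow> 'h mtree) \<Rightarrow> 'g mtree \<Rightarrow> 'h mtree" where
  "graft f (Leaf g) = f g"
| "graft f (Br s t) = Br (graft f s) (graft f t)"

text \<open>Generators of the direct sum of the free magma rings on the tensor groups,
  indexed by (m,u) with m = (m_1,...,m_k) and u \<in> B(m).\<close>
definition dom_gens :: "nat \<Rightarrow> (nat \<Rightarrow> 'a set) \<Rightarrow> (nat list \<times> nat list \<times> 'a list list mtree) set" where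
  "dom_gens k X = {(m, u, t). length m = k \<and> u \<in> lyndon_B m \<and> t \<in> trees (tensor_basis k X m)}"

definition embed :: "nat list \<Rightarrow> nat list \<Rightarrow> ('g mtree \<Rightarrow>\<^sub>0 int) \<Rightarrow> ((nat list \<times> nat list \<times> 'g mtree) \<Rightarrow>\<^sub>0 int)" where
  "embed m u y = lin_ext (\<lambda>t. (m, u, t)) y"

inductive_set dom_ideal :: "nat \<Rightarrow> (nat \<Rightarrow> 'a set) \<Rightarrow> ((nat list \<times> nat list \<times> 'a list list mtree) \<Rightarrow>\<^sub>0 int) set"
  for k X where
  emb: "length m = k \<Longrightarrow> u \<in> lyndon_B m \<Longrightarrow> y \<in> lie_ideal (tensor_basis k X m) \<Longrightarrow> embed m u y \<in> dom_ideal k X"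
| zero: "0 \<in> dom_ideal k X"
| add: "x \<in> dom_ideal k X \<Longrightarrow> y \<in> dom_ideal k X \<Longrightarrow> x + y \<in> dom_ideal k X"

definition dom_sum :: "nat \<Rightarrow> (nat \<Rightarrow> 'a set) \<Rightarrow> ((nat list \<times> nat list \<times> 'a list list mtree) \<Rightarrow>\<^sub>0 int) set set" where
  "dom_sum k X = quot (FA (dom_gens k X)) (dom_ideal k X)"

definition beta_sum :: "((nat list \<times> nat list \<times> 'a list list mtree) \<Rightarrow>\<^sub>0 int) \<Rightarrow> ((nat \<times> 'a) mtree \<Rightarrow>\<^sub>0 int)" where
  "beta_sum = lin_ext (\<lambda>(m, u, t). graft (beta_tree u) t)"

end

theory Submission
  imports Defs "HOL-Library.List_Lexorder" "HOL-Library.Z2"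
begin

text \<open>
  Over the integers an element of the free Lie algebra is not determined by its image in the tensor
  algebra, because the squares $[y,y]$ are central, additive in $y$ and killed by 2, but nonzero.

  Surjectivity: a bracket of monomials attached to Lyndon words $u < v$ is rewritten by the Jacobi
  identity until every pair $(u,v)$ is a standard factorisation of $uv$; each step increases the smaller
  of the two words.

  Injectivity: in the tensor algebra over any commutative ring, the image under $\tilde\beta_u$ of
  an $n$-fold tensor has leading term over the word $u^n$, where $\tilde\beta_u$ is the identity, and
  the words $u^n$ are pairwise distinct. Applied to rank one groups $V_i$ this shows that the kernel of
  the map to the tensor algebra consists of squares, and that $[y,y] = 0$ if the image of $y$ is even.
  Conversely, if $[y,y] = 0$ then the image of $y$ is even: for each word $w$ a bilinear form built from
  half-shuffles is compatible with antisymmetry and the Jacobi identity modulo 2 and maps $[y,y]$ to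
  the coefficient of $w$ in $y$. So if $\sum_u \tilde\beta_u(x_u) = 0$, then $x_u = [y_u,y_u]$, the
  square of $\sum_u \tilde\beta_u(y_u)$ vanishes, hence all $y_u$ have even image and $x_u = 0$.
\<close>

subsection \<open>Additive maps on free abelian groups\<close>

text \<open>Leading terms alone cannot give injectivity: they show that every component of a kernel
  element dies in the tensor algebra, and over the integers this does not make the component zero,
  so the kernel of the map to the tensor algebra has to be determined first. The theorem in rank one
  does this. An element involves finitely many generators; if each of them spans its own group V_i =
  Z, every tensor product is again a copy of Z, and the free Lie algebra on one generator a is
  spanned by a and [a,a]. Surjectivity thus gives an explicit spanning set of the free Lie algebra,
  to which triangularity applies. The coefficient ring of the tensor algebra stays arbitrary because
  two choices matter: over \<open>int\<close> the coefficients of the a vanish, over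
  \<open>bit\<close> they are even. The field with two elements has a second use: there c^2 = c, so
  a quadratic form whose value at y is the square of a coefficient detects the coefficient
  itself.\<close>

definition lin_val :: "('b \<Rightarrow> 'r::comm_ring_1) \<Rightarrow> ('b \<Rightarrow>\<^sub>0 int) \<Rightarrow> 'r" where
  "lin_val h x = (\<Sum>b\<in>Poly_Mapping.keys x. of_int (Poly_Mapping.lookup x b) * h b)"

lemma lin_val_superset:
  assumes "finite K" "Poly_Mapping.keys x \<subseteq> K"
  shows "lin_val h x = (\<Sum>b\<in>K. of_int (Poly_Mapping.lookup x b) * h b)"
  unfolding lin_val_def using assms
  by (intro sum.mono_neutral_left) (auto simp: in_keys_iff)

lemma lin_val_0 [simp]: "lin_val h 0 = 0"
  by (simp add: lin_val_def)

lemma lin_val_of [simp]: "lin_val h (frag_of b) = h b"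
  by (simp add: lin_val_def)

lemma lin_val_add: "lin_val h (x + y) = lin_val h x + lin_val h y"
proof -
  let ?K = "Poly_Mapping.keys x \<union> Poly_Mapping.keys y"
  have "Poly_Mapping.keys (x + y) \<subseteq> ?K" by (rule keys_add)
  then show ?thesis
    by (simp add: lin_val_superset[of ?K] lookup_add algebra_simps sum.distrib)
qed

lemma lin_val_minus: "lin_val h (- x) = - lin_val h x"
  using lin_val_add[of h x "- x"] by (simp add: add_eq_0_iff)

lemma lin_val_diff: "lin_val h (x - y) = lin_val h x - lin_val h y"
  using lin_val_add[of h x "- y"] by (simp add: lin_val_minus)

lemma lin_val_cmul: "lin_val h (frag_cmul c x) = of_int c * lin_val h x"
proof -
  have "lin_val h (frag_cmul c x) = (\<Sum>b\<in>Poly_Mapping.keys x. of_int (c * Poly_Mapping.lookup x b) * h b)"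
    by (subst lin_val_superset[of "Poly_Mapping.keys x"]) auto
  then show ?thesis by (simp add: lin_val_def sum_distrib_left mult.assoc)
qed

text \<open>The sum in \<open>lin_ext\<close> runs over a support that changes under addition; in
  the form \<open>frag_extend\<close> additivity is already known.\<close>

lemma lin_ext_eq: "lin_ext f = frag_extend (\<lambda>b. frag_of (f b))"
proof -
  have "Poly_Mapping.single c n = frag_cmul n (frag_of c)" for c :: 'b and n
    by (rule poly_mapping_eqI) (simp add: lookup_single)
  then show ?thesis
    unfolding lin_ext_def frag_extend_def by (intro ext sum.cong refl)
qed

lemma lin_ext_0 [simp]: "lin_ext f 0 = 0"
  and lin_ext_of [simp]: "lin_ext f (frag_of b) = frag_of (f b)"
  and lin_ext_add: "lin_ext f (x + y) = lin_ext f x + lin_ext f y"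
  and lin_ext_minus: "lin_ext f (- x) = - lin_ext f x"
  and lin_ext_diff: "lin_ext f (x - y) = lin_ext f x - lin_ext f y"
  by (simp_all add: lin_ext_eq frag_extend_add frag_extend_minus frag_extend_diff)

lemma lin_ext_sum: "lin_ext f (\<Sum>i\<in>I. g i) = (\<Sum>i\<in>I. lin_ext f (g i))"
  by (induction I rule: infinite_finite_induct) (auto simp: lin_ext_add)

lemma lin_ext_lin_ext: "lin_ext f (lin_ext g x) = lin_ext (\<lambda>b. f (g b)) x"
  using subset_UNIV by (induction x rule: frag_induction) (auto simp: lin_ext_diff)

lemma lin_ext_id: "(\<And>b. b \<in> Poly_Mapping.keys x \<Longrightarrow> f b = b) \<Longrightarrow> lin_ext f x = x"
  using frag_expansion[of x, symmetric] by (simp add: lin_ext_eq frag_extend_def)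

lemma lin_val_lin_ext: "lin_val h (lin_ext f x) = lin_val (\<lambda>b. h (f b)) x"
  using subset_UNIV by (induction x rule: frag_induction) (auto simp: lin_ext_diff lin_val_diff)

lemma frag_cmul_diff_distrib2: "frag_cmul c (a - b) = frag_cmul c a - frag_cmul c b"
  by (rule poly_mapping_eqI) (simp add: lookup_minus algebra_simps)

lemma FA_0 [simp]: "0 \<in> FA S"
  and FA_of [simp]: "frag_of b \<in> FA S \<longleftrightarrow> b \<in> S"
  by (simp_all add: FA_def)

lemma FA_add: "x \<in> FA S \<Longrightarrow> y \<in> FA S \<Longrightarrow> x + y \<in> FA S"
  using keys_add[of x y] by (auto simp: FA_def)

lemma FA_minus: "x \<in> FA S \<Longrightarrow> - x \<in> FA S"
  by (simp add: FA_def)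

lemma FA_diff: "x \<in> FA S \<Longrightarrow> y \<in> FA S \<Longrightarrow> x - y \<in> FA S"
  using keys_diff[of x y] by (auto simp: FA_def)

lemma FA_sum: "(\<And>i. i \<in> I \<Longrightarrow> f i \<in> FA S) \<Longrightarrow> (\<Sum>i\<in>I. f i) \<in> FA S"
  by (induction I rule: infinite_finite_induct) (auto intro: FA_add)

lemma FA_cmul: "x \<in> FA S \<Longrightarrow> frag_cmul c x \<in> FA S"
  using keys_cmul[of c x] by (auto simp: FA_def)

lemma FA_mono: "S \<subseteq> T \<Longrightarrow> x \<in> FA S \<Longrightarrow> x \<in> FA T"
  by (auto simp: FA_def)

lemma FA_induct [consumes 1, case_names zero one diff]:
  assumes "x \<in> FA S" "P 0" "\<And>b. b \<in> S \<Longrightarrow> P (frag_of b)"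
    and "\<And>a b. P a \<Longrightarrow> P b \<Longrightarrow> P (a - b)"
  shows "P x"
  using assms by (intro frag_induction[of x S P]) (auto simp: FA_def)

lemma lin_ext_FA: "x \<in> FA S \<Longrightarrow> (\<And>b. b \<in> S \<Longrightarrow> f b \<in> T) \<Longrightarrow> lin_ext f x \<in> FA T"
  by (induction x rule: FA_induct) (auto simp: lin_ext_diff FA_diff)

subsection \<open>The bracket and the Lie ideal\<close>

lemma bracket_eq: "bracket x y = frag_extend (\<lambda>s. frag_extend (\<lambda>t. frag_of (Br s t)) y) x"
proof -
  have "Poly_Mapping.single c (n * m) = frag_cmul n (frag_cmul m (frag_of c))" for c :: "'a mtree" and n m
    by (rule poly_mapping_eqI) (simp add: lookup_single)
  then show ?thesis
    by (simp only: bracket_def frag_extend_def frag_cmul_sum)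
qed

lemma bracket_0_left [simp]: "bracket 0 y = 0"
  and bracket_of [simp]: "bracket (frag_of s) (frag_of t) = frag_of (Br s t)"
  and bracket_add_left: "bracket (x + x') y = bracket x y + bracket x' y"
  and bracket_diff_left: "bracket (x - x') y = bracket x y - bracket x' y"
  and bracket_cmul_left: "bracket (frag_cmul c x) y = frag_cmul c (bracket x y)"
  by (simp_all add: bracket_eq frag_extend_add frag_extend_diff frag_extend_minus frag_extend_cmul)

lemma bracket_0_right [simp]: "bracket x 0 = 0"
  by (simp add: bracket_eq frag_extend_def)

lemma bracket_diff_right: "bracket x (y - y') = bracket x y - bracket x y'"
  using subset_UNIV
  by (induction x rule: frag_induction) (auto simp: bracket_eq frag_extend_diff)

lemma bracket_minus_right: "bracket x (- y) = - bracket x y"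
  using bracket_diff_right[of x 0 y] by simp

lemma bracket_add_right: "bracket x (y + y') = bracket x y + bracket x y'"
  using bracket_diff_right[of x y "- y'"] by (simp add: bracket_minus_right)

lemma bracket_cmul_right: "bracket x (frag_cmul c y) = frag_cmul c (bracket x y)"
  using subset_UNIV
  by (induction x rule: frag_induction)
     (auto simp: bracket_diff_left frag_cmul_diff_distrib2, simp add: bracket_eq frag_extend_cmul)

lemma trees_simps [simp]:
  "Leaf g \<in> trees S \<longleftrightarrow> g \<in> S"
  "Br s t \<in> trees S \<longleftrightarrow> s \<in> trees S \<and> t \<in> trees S"
  by (auto simp: trees_def)

text \<open>Nested inductions on the two arguments: for a property closed under differences, such as
  membership in a subgroup, bilinearity leaves only brackets of single trees to check.\<close>

lemma bilinear_induct:
  assumes "x \<in> FA S" "y \<in> FA T"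
    and "P 0" "\<And>a b. P a \<Longrightarrow> P b \<Longrightarrow> P (a - b)"
    and "\<And>s t. s \<in> S \<Longrightarrow> t \<in> T \<Longrightarrow> P (frag_of (Br s t))"
  shows "P (bracket x y)"
  using assms(1)
proof (induction x rule: FA_induct)
  case (one s)
  from assms(2) show ?case
    by (induction y rule: FA_induct) (use assms(3-) one in \<open>auto simp: bracket_diff_right\<close>)
qed (use assms(3-) in \<open>auto simp: bracket_diff_left\<close>)

lemma bracket_FA [intro]:
  assumes "x \<in> FA (trees S)" "y \<in> FA (trees S)"
  shows "bracket x y \<in> FA (trees S)"
  using assms by (rule bilinear_induct) (auto simp: FA_diff)

lemma lie_ideal_FA: "x \<in> lie_ideal S \<Longrightarrow> x \<in> FA (trees S)"
  by (induction rule: lie_ideal.induct) (auto intro!: FA_add FA_minus)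

lemma lie_ideal_diff: "x \<in> lie_ideal S \<Longrightarrow> y \<in> lie_ideal S \<Longrightarrow> x - y \<in> lie_ideal S"
  using lie_ideal.add[of x S "- y"] lie_ideal.neg by fastforce

lemma lie_ideal_sum: "(\<And>i. i \<in> I \<Longrightarrow> f i \<in> lie_ideal S) \<Longrightarrow> (\<Sum>i\<in>I. f i) \<in> lie_ideal S"
  by (induction I rule: infinite_finite_induct) (auto intro: lie_ideal.intros)

lemma lie_ideal_cmul: "x \<in> lie_ideal S \<Longrightarrow> frag_cmul c x \<in> lie_ideal S"
  by (rule frag_closure_minus_cmul) (auto intro: lie_ideal.zero lie_ideal_diff)

lemma lie_ideal_minus_iff: "- x \<in> lie_ideal S \<longleftrightarrow> x \<in> lie_ideal S"
  using lie_ideal.neg by fastforce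

lemma lie_ideal_cong:
  assumes "x - y \<in> lie_ideal S" shows "x \<in> lie_ideal S \<longleftrightarrow> y \<in> lie_ideal S"
  using assms lie_ideal.add[of "x - y" S y] lie_ideal_diff[of x S "x - y"] by auto

text \<open>The difference telescopes as [x - x', y] + [x', y - y'], which is why x' and y are the
  ones required to lie in \<open>FA (trees S)\<close>.\<close>

lemma bracket_cong_ideal:
  assumes "x - x' \<in> lie_ideal S" "y - y' \<in> lie_ideal S"
    and "x' \<in> FA (trees S)" "y \<in> FA (trees S)"
  shows "bracket x y - bracket x' y' \<in> lie_ideal S"
proof -
  have "bracket x y - bracket x' y' = bracket (x - x') y + bracket x' (y - y')"
    by (simp add: bracket_diff_left bracket_diff_right)
  then show ?thesis using assms by (auto intro: lie_ideal.intros)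
qed

section \<open>Squares modulo the Lie ideal\<close>

lemma square_add:
  assumes "a \<in> FA (trees S)" "b \<in> FA (trees S)"
  shows "bracket (a + b) (a + b) - (bracket a a + bracket b b) \<in> lie_ideal S"
proof -
  have "bracket (a + b) (a + b) - (bracket a a + bracket b b) = bracket a b + bracket b a"
    by (simp add: bracket_add_left bracket_add_right)
  then show ?thesis using assms by (simp add: lie_ideal.antisym)
qed

text \<open>Squaring looks quadratic but is additive modulo the ideal, since the cross terms [a,b] +
  [b,a] are antisymmetry relations.\<close>

lemma square_sum:
  assumes "finite I" "\<And>i. i \<in> I \<Longrightarrow> f i \<in> FA (trees S)"
  shows "bracket (\<Sum>i\<in>I. f i) (\<Sum>i\<in>I. f i) - (\<Sum>i\<in>I. bracket (f i) (f i)) \<in> lie_ideal S"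
  using assms
proof (induction I rule: finite_induct)
  case (insert i I)
  let ?s = "\<Sum>i\<in>I. f i" and ?q = "\<Sum>i\<in>I. bracket (f i) (f i)"
  have "bracket (f i + ?s) (f i + ?s) - (bracket (f i) (f i) + bracket ?s ?s) \<in> lie_ideal S"
    using insert by (intro square_add FA_sum) auto
  moreover have "bracket ?s ?s - ?q \<in> lie_ideal S" using insert by auto
  ultimately have "bracket (f i + ?s) (f i + ?s) - (bracket (f i) (f i) + bracket ?s ?s) + (bracket ?s ?s - ?q) \<in> lie_ideal S"
    by (rule lie_ideal.add)
  then show ?case using insert by (simp add: algebra_simps)
qed (auto intro: lie_ideal.zero)

lemma double_square:
  assumes "a \<in> FA (trees S)" shows "bracket a a + bracket a a \<in> lie_ideal S"
  using lie_ideal.antisym[OF assms assms] .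

text \<open>In the Jacobi relation for a, a, b the two terms other than [b,[a,a]] add up to [a,
  [a,b] + [b,a]], a bracket with an antisymmetry relation.\<close>

lemma square_central:
  assumes "a \<in> FA (trees S)" "b \<in> FA (trees S)"
  shows "bracket b (bracket a a) \<in> lie_ideal S" "bracket (bracket a a) b \<in> lie_ideal S"
proof -
  have "bracket a (bracket a b) + bracket b (bracket a a) + bracket a (bracket b a) \<in> lie_ideal S"
    using assms by (intro lie_ideal.jacobi)
  moreover have "bracket a (bracket a b + bracket b a) \<in> lie_ideal S"
    using assms by (intro lie_ideal.brr lie_ideal.antisym)
  ultimately have "bracket a (bracket a b) + bracket b (bracket a a) + bracket a (bracket b a)
      - bracket a (bracket a b + bracket b a) \<in> lie_ideal S" by (rule lie_ideal_diff)
  then show 1: "bracket b (bracket a a) \<in> lie_ideal S"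
    by (simp add: bracket_add_right)
  have "bracket b (bracket a a) + bracket (bracket a a) b \<in> lie_ideal S"
    using assms by (intro lie_ideal.antisym) auto
  from lie_ideal_diff[OF this 1] show "bracket (bracket a a) b \<in> lie_ideal S" by simp
qed

section \<open>Substitution of trees for generators\<close>

lemma graft_trees:
  "(\<And>g. g \<in> S \<Longrightarrow> f g \<in> trees T) \<Longrightarrow> t \<in> trees S \<Longrightarrow> graft f t \<in> trees T"
  by (induction t) auto

lemma lin_ext_graft_bracket:
  "lin_ext (graft f) (bracket x y) = bracket (lin_ext (graft f) x) (lin_ext (graft f) y)"
proof -
  have "lin_ext (graft f) (bracket (frag_of s) y) = bracket (frag_of (graft f s)) (lin_ext (graft f) y)" for s
    using subset_UNIV
    by (induction y rule: frag_induction) (auto simp: lin_ext_diff bracket_diff_right)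
  with subset_UNIV show ?thesis
    by (induction x rule: frag_induction) (auto simp: lin_ext_diff bracket_diff_left)
qed

lemma lin_ext_graft_ideal:
  assumes f: "\<And>g. g \<in> S \<Longrightarrow> f g \<in> trees T" and "x \<in> lie_ideal S"
  shows "lin_ext (graft f) x \<in> lie_ideal T"
proof -
  have *: "lin_ext (graft f) y \<in> FA (trees T)" if "y \<in> FA (trees S)" for y
    using that by (rule lin_ext_FA) (auto intro: graft_trees f)
  from assms(2) show ?thesis
    by induction
       (auto simp: lin_ext_graft_bracket lin_ext_add lin_ext_minus intro: lie_ideal.intros *)
qed

subsection \<open>The tensor algebra\<close>

text \<open>An element of the tensor algebra is encoded by its coefficient function on words; this is
  the concatenation product.\<close>

fun conv :: "('g list \<Rightarrow> 'r::comm_ring_1) \<Rightarrow> ('g list \<Rightarrow> 'r) \<Rightarrow> 'g list \<Rightarrow> 'r" where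
  "conv F G [] = F [] * G []"
| "conv F G (x # w) = F [] * G (x # w) + conv (\<lambda>z. F (x # z)) G w"

lemma conv_sum_split: "conv F G w = (\<Sum>i\<le>length w. F (take i w) * G (drop i w))"
proof (induction w arbitrary: F)
  case (Cons x w)
  then show ?case by (simp add: sum.atMost_Suc_shift del: sum.atMost_Suc)
qed simp

lemma conv_add_left: "conv (\<lambda>z. F z + F' z) G w = conv F G w + conv F' G w"
  and conv_add_right: "conv F (\<lambda>z. G z + G' z) w = conv F G w + conv F G' w"
  and conv_diff_left: "conv (\<lambda>z. F z - F' z) G w = conv F G w - conv F' G w"
  and conv_diff_right: "conv F (\<lambda>z. G z - G' z) w = conv F G w - conv F G' w"
  and conv_cmul_left: "conv (\<lambda>z. c * F z) G w = c * conv F G w"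
  and conv_cmul_right: "conv F (\<lambda>z. c * G z) w = c * conv F G w"
  by (simp_all add: conv_sum_split algebra_simps sum.distrib sum_subtractf sum_distrib_left)

lemma conv_0_left [simp]: "conv (\<lambda>z. 0) G w = 0"
  and conv_0_right [simp]: "conv F (\<lambda>z. 0) w = 0"
  by (simp_all add: conv_sum_split)

lemma conv_sum_left: "conv (\<lambda>z. \<Sum>i\<in>I. F i z) G w = (\<Sum>i\<in>I. conv (F i) G w)"
  by (induction I rule: infinite_finite_induct) (auto simp: conv_add_left)

lemma conv_sum_right: "conv G (\<lambda>z. \<Sum>i\<in>I. F i z) w = (\<Sum>i\<in>I. conv G (F i) w)"
  by (induction I rule: infinite_finite_induct) (auto simp: conv_add_right)

text \<open>Removing the first letter turns \<open>conv F G\<close> into a multiple of a shifted G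
  plus a convolution with a shifted F; hence F must be arbitrary in the induction, and linearity
  does the rest.\<close>

lemma conv_assoc: "conv (conv F G) H w = conv F (conv G H) w"
  by (induction w arbitrary: F)
     (simp_all add: conv_add_left conv_cmul_left algebra_simps)

lemma conv_nonzero:
  assumes "conv F G w \<noteq> 0"
  obtains a b where "w = a @ b" "F a \<noteq> 0" "G b \<noteq> 0"
proof -
  from assms obtain i where "F (take i w) * G (drop i w) \<noteq> 0"
    unfolding conv_sum_split by (meson sum.neutral)
  then show thesis
    by (intro that[of "take i w" "drop i w"]) auto
qed

text \<open>The image of a monomial in the tensor algebra, with brackets read as
  commutators.\<close>

primrec tau :: "'g mtree \<Rightarrow> 'g list \<Rightarrow> 'r::comm_ring_1" where
  "tau (Leaf g) = (\<lambda>w. if w = [g] then 1 else 0)"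
| "tau (Br s t) = (\<lambda>w. conv (tau s) (tau t) w - conv (tau t) (tau s) w)"

definition taux :: "('g mtree \<Rightarrow>\<^sub>0 int) \<Rightarrow> 'g list \<Rightarrow> 'r::comm_ring_1" where
  "taux x w = lin_val (\<lambda>t. tau t w) x"

lemma taux_0 [simp]: "taux 0 = (\<lambda>w. 0)"
  and taux_of [simp]: "taux (frag_of t) = tau t"
  and taux_add: "taux (x + y) = (\<lambda>w. taux x w + taux y w)"
  and taux_diff: "taux (x - y) = (\<lambda>w. taux x w - taux y w)"
  and taux_minus: "taux (- x) = (\<lambda>w. - taux x w)"
  and taux_cmul: "taux (frag_cmul c x) = (\<lambda>w. of_int c * taux x w)"
  by (auto simp: taux_def lin_val_add lin_val_diff lin_val_minus lin_val_cmul)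

lemma taux_bracket:
  fixes x y :: "'g mtree \<Rightarrow>\<^sub>0 int"
  shows "(taux (bracket x y) :: _ \<Rightarrow> 'r::comm_ring_1) = (\<lambda>w. conv (taux x) (taux y) w - conv (taux y) (taux x) w)"
proof -
  have "taux (bracket (frag_of s) y) =
      (\<lambda>w. conv (tau s) (taux y) w - conv (taux y) (tau s) w :: 'r)" for s
    using subset_UNIV
    by (induction y rule: frag_induction)
       (auto simp: taux_diff bracket_diff_right conv_diff_left conv_diff_right)
  with subset_UNIV show ?thesis
    by (induction x rule: frag_induction)
       (auto simp: taux_diff bracket_diff_left conv_diff_left conv_diff_right)
qed

text \<open>Commutators are antisymmetric, and Jacobi follows from associativity of concatenation.
  The converse fails: every [a,a] maps to 0.\<close>

lemma taux_ideal: "x \<in> lie_ideal S \<Longrightarrow> taux x = (\<lambda>w. 0::'r::comm_ring_1)"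
  by (induction rule: lie_ideal.induct)
     (auto simp: taux_bracket taux_add taux_minus conv_diff_left conv_diff_right conv_assoc)

primrec leaves :: "'g mtree \<Rightarrow> nat" where
  "leaves (Leaf g) = 1"
| "leaves (Br s t) = leaves s + leaves t"

lemma finite_set_mtree [simp]: "finite (set_mtree t)"
  by (induction t) auto

lemma leaves_pos [simp]: "leaves t > 0" "leaves t \<noteq> 0"
  by (induction t) auto

lemma tau_support:
  assumes "tau t w \<noteq> (0::'r::comm_ring_1)" shows "length w = leaves t \<and> set w \<subseteq> set_mtree t"
  using assms
proof (induction t arbitrary: w)
  case (Br s t)
  then consider "conv (tau s) (tau t :: _ \<Rightarrow> 'r) w \<noteq> 0" | "conv (tau t) (tau s :: _ \<Rightarrow> 'r) w \<noteq> 0"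
    by fastforce
  then show ?case
    by cases (erule conv_nonzero, use Br.IH in fastforce)+
qed (auto split: if_splits)

subsection \<open>Shuffles\<close>

text \<open>The sum of the values of $F$ at all shuffles of two words, with multiplicity.\<close>

fun sh :: "('g list \<Rightarrow> 'r::comm_ring_1) \<Rightarrow> 'g list \<Rightarrow> 'g list \<Rightarrow> 'r" where
  "sh F [] v = F v"
| "sh F (x # u) [] = F (x # u)"
| "sh F (x # u) (y # v) = sh (\<lambda>z. F (x # z)) u (y # v) + sh (\<lambda>z. F (y # z)) (x # u) v"

text \<open>Half-shuffles: only the shuffles that start with the first letter of the first word.\<close>

fun hsh :: "('g list \<Rightarrow> 'r::comm_ring_1) \<Rightarrow> 'g list \<Rightarrow> 'g list \<Rightarrow> 'r" where
  "hsh F [] v = 0"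
| "hsh F (x # u) v = sh (\<lambda>z. F (x # z)) u v"

lemma sh_Nil_right [simp]: "sh F u [] = F u"
  by (cases u) auto

lemma sh_comm: "sh F u v = sh F v u"
  by (induction F u v rule: sh.induct) (auto simp: add.commute)

lemma sh_eq_hsh: "u \<noteq> [] \<Longrightarrow> v \<noteq> [] \<Longrightarrow> sh F u v = hsh F u v + hsh F v u"
  by (cases u; cases v) (auto simp: sh_comm)

lemma sh_add: "sh (\<lambda>z. F z + G z) u v = sh F u v + sh G u v"
proof (induction F u v arbitrary: G rule: sh.induct)
  case (3 F x u y v)
  show ?case
    using 3(1)[of "\<lambda>z. G (x # z)"] 3(2)[of "\<lambda>z. G (y # z)"] by simp
qed auto

lemma sh_diff: "sh (\<lambda>z. F z - G z) u v = sh F u v - sh G u v"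
  using sh_add[of "\<lambda>z. F z - G z" G u v] by simp

lemma sh_cmul: "sh (\<lambda>z. c * F z) u v = c * sh F u v"
proof (induction F u v rule: sh.induct)
  case (3 F x u y v)
  then show ?case by (simp add: algebra_simps)
qed auto

lemma hsh_diff: "hsh (\<lambda>z. F z - G z) u v = hsh F u v - hsh G u v"
  by (cases u) (simp_all add: sh_diff)

lemma sh_0 [simp]: "sh (\<lambda>z. 0) u v = 0"
  using sh_diff[of "\<lambda>z. 0" "\<lambda>z. 0"] by simp

lemma hsh_0 [simp]: "hsh (\<lambda>z. 0) u v = 0"
  by (cases u) auto

lemma hsh_Nil_right: "u \<noteq> [] \<Longrightarrow> hsh F u [] = F u"
  by (cases u) auto

text \<open>Shuffling is dual to a coproduct that is multiplicative for concatenation.\<close>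

lemma sh_conv:
  "sh (conv G H) u v =
    (\<Sum>a\<le>length u. \<Sum>b\<le>length v. sh G (take a u) (take b v) * sh H (drop a u) (drop b v))"
proof (induction G u v rule: sh.induct)
  case (1 G v)
  show ?case by (simp add: conv_sum_split)
next
  case (2 G x u)
  show ?case by (simp add: conv_sum_split del: conv.simps)
next
  case (3 G x u y v)
  let ?t = "\<lambda>a b. sh G (take a (x # u)) (take b (y # v)) * sh H (drop a (x # u)) (drop b (y # v))"
  let ?Gx = "\<lambda>z. G (x # z)" and ?Gy = "\<lambda>z. G (y # z)"
  let ?p = "\<lambda>a b. sh ?Gx (take a u) (take b (y # v)) * sh H (drop a u) (drop b (y # v))"
  let ?q = "\<lambda>a b. sh ?Gy (take a (x # u)) (take b v) * sh H (drop a (x # u)) (drop b v)"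
  \<comment> \<open>A shuffle of two nonempty prefixes starts with x or with y. If one of the
    prefixes is empty, only one of these alternatives remains, so the edges of the rectangle of cuts
    are treated apart.\<close>
  have e: "?t (Suc a) (Suc b) = ?p a (Suc b) + ?q (Suc a) b" for a b
    by (simp add: algebra_simps)
  have e0: "?t (Suc a) 0 = ?p a 0" for a by simp
  have e1: "?t 0 (Suc b) = ?q 0 b" for b by simp
  have "(\<Sum>a\<le>length (x # u). \<Sum>b\<le>length (y # v). ?t a b) =
      ?t 0 0 + (\<Sum>b\<le>length v. ?t 0 (Suc b)) + (\<Sum>a\<le>length u. ?t (Suc a) 0)
      + (\<Sum>a\<le>length u. \<Sum>b\<le>length v. ?t (Suc a) (Suc b))"
    by (simp only: length_Cons sum.atMost_Suc_shift sum.distrib add_ac)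
  also have "\<dots> = ?t 0 0 + ((\<Sum>a\<le>length u. ?p a 0) + (\<Sum>a\<le>length u. \<Sum>b\<le>length v. ?p a (Suc b)))
      + ((\<Sum>b\<le>length v. ?q 0 b) + (\<Sum>a\<le>length u. \<Sum>b\<le>length v. ?q (Suc a) b))"
    by (simp only: e e0 e1 sum.distrib add_ac)
  also have "(\<Sum>a\<le>length u. ?p a 0) + (\<Sum>a\<le>length u. \<Sum>b\<le>length v. ?p a (Suc b)) = sh (conv ?Gx H) u (y # v)"
    by (simp only: 3 length_Cons sum.atMost_Suc_shift sum.distrib)
  also have "(\<Sum>b\<le>length v. ?q 0 b) + (\<Sum>a\<le>length u. \<Sum>b\<le>length v. ?q (Suc a) b) = sh (conv ?Gy H) (x # u) v"
    by (simp only: 3 length_Cons sum.atMost_Suc_shift)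
  also have "?t 0 0 + sh (conv ?Gx H) u (y # v) + sh (conv ?Gy H) (x # u) v = sh (conv G H) (x # u) (y # v)"
    by (simp add: sh_add sh_cmul algebra_simps)
  finally show ?case by simp
qed

text \<open>All shuffles counted here begin with the first letter of u. As G vanishes on the empty
  word, this letter goes to G: so G sees a half-shuffle, H a full shuffle, and the cut a = 0 is
  missing.\<close>

lemma hsh_conv:
  assumes "G [] = 0"
  shows "hsh (conv G H) u v =
    (\<Sum>a=1..length u. \<Sum>b\<le>length v. hsh G (take a u) (take b v) * sh H (drop a u) (drop b v))"
proof (cases u)
  case (Cons x u')
  have "hsh (conv G H) u v = sh (conv (\<lambda>z. G (x # z)) H) u' v"
    using assms by (simp add: Cons)
  also have "\<dots> = (\<Sum>a\<le>length u'. \<Sum>b\<le>length v.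
      hsh G (take (Suc a) u) (take b v) * sh H (drop (Suc a) u) (drop b v))"
    by (simp add: sh_conv Cons)
  also have "\<dots> = (\<Sum>a=1..length u. \<Sum>b\<le>length v. hsh G (take a u) (take b v) * sh H (drop a u) (drop b v))"
    by (rule sum.reindex_bij_witness[of _ "\<lambda>a. a - 1" Suc]) (auto simp: Cons)
  finally show ?thesis .
qed simp

text \<open>Ree's criterion: vanishing on proper shuffles is primitivity for the unshuffle
  coproduct, written in dual form.\<close>

definition primitive :: "('g list \<Rightarrow> 'r::comm_ring_1) \<Rightarrow> bool" where
  "primitive F \<longleftrightarrow> F [] = 0 \<and> (\<forall>u v. u \<noteq> [] \<longrightarrow> v \<noteq> [] \<longrightarrow> sh F u v = 0)"

lemma primitive_Nil: "primitive F \<Longrightarrow> F [] = 0"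
  by (simp add: primitive_def)

text \<open>Each factor may see letters of one of the two words only, so just two pairs of cuts
  survive. The result is symmetric in F and G and therefore cancels in a commutator.\<close>

lemma sh_conv_primitive:
  assumes "primitive F" "primitive G" "u \<noteq> []" "v \<noteq> []"
  shows "sh (conv F G) u v = F u * G v + F v * G u"
proof -
  let ?f = "\<lambda>a b. sh F (take a u) (take b v) * sh G (drop a u) (drop b v)"
  have z: "?f a b = 0" if ab: "a \<le> length u" "b \<le> length v" "(a, b) \<noteq> (0, length v)" "(a, b) \<noteq> (length u, 0)" for a b
  proof (rule ccontr)
    assume n: "?f a b \<noteq> 0"
    then have "sh F (take a u) (take b v) \<noteq> 0" "sh G (drop a u) (drop b v) \<noteq> 0" by auto
    then have "take a u = [] \<or> take b v = []" "drop a u = [] \<or> drop b v = []"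
      using assms unfolding primitive_def by blast+
    then consider "a = 0" "b = 0" | "a = length u" "b = length v"
      using ab assms by auto
    then show False using n assms by cases (auto simp: primitive_def)
  qed
  have "sh (conv F G) u v = (\<Sum>p\<in>{..length u} \<times> {..length v}. ?f (fst p) (snd p))"
    by (simp add: sh_conv sum.cartesian_product case_prod_beta)
  also have "\<dots> = (\<Sum>p\<in>{(0, length v), (length u, 0)}. ?f (fst p) (snd p))"
  proof (rule sum.mono_neutral_right)
    show "\<forall>p\<in>{..length u} \<times> {..length v} - {(0, length v), (length u, 0)}. ?f (fst p) (snd p) = 0"
    proof
      fix p assume "p \<in> {..length u} \<times> {..length v} - {(0, length v), (length u, 0)}"
      then show "?f (fst p) (snd p) = 0" by (intro z) (auto simp: prod_eq_iff)
    qed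
  qed auto
  also have "\<dots> = F u * G v + F v * G u" using assms by simp
  finally show ?thesis .
qed

lemma primitive_commutator:
  assumes "primitive F" "primitive G"
  shows "primitive (\<lambda>w. conv F G w - conv G F w)"
  using assms unfolding primitive_def[of "\<lambda>w. conv F G w - conv G F w"]
  by (auto simp: sh_diff sh_conv_primitive primitive_def)

lemma primitive_tau: "primitive (tau t)"
proof (induction t)
  case (Leaf g)
  have "sh (\<lambda>w. if w = [g] then 1 else 0) u v = (0::'b)" if "u \<noteq> []" "v \<noteq> []" for u v
  proof -
    \<comment> \<open>Only the length of the words matters, a condition on F that passes to the
      shifted functions in the recursion of \<open>sh\<close>.\<close>
    have "sh F u v = 0" if "\<And>w. length w \<ge> length u + length v \<Longrightarrow> F w = (0::'b)" for F :: "_ \<Rightarrow> 'b"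
      using that by (induction F u v rule: sh.induct) auto
    moreover have "length u + length v \<ge> 2" using that by (cases u; cases v) auto
    ultimately show ?thesis by fastforce
  qed
  then show ?case by (simp add: primitive_def)
qed (simp add: primitive_commutator)

lemma primitive_taux: "primitive (taux x)"
  using subset_UNIV
proof (induction x rule: frag_induction)
  case (one t)
  then show ?case by (simp add: primitive_tau)
next
  case (diff x y)
  then show ?case by (simp add: taux_diff primitive_def sh_diff)
qed (simp add: primitive_def)

subsection \<open>A functional detecting squares modulo 2\<close>

text \<open>The form below is the polarisation, divided by two, of the half-shuffle of $w$ with itself
  evaluated on a commutator. Half-shuffles $u \prec v$ and $v \prec u$ add up to a shuffle, which
  vanishes on Lie elements, so modulo 2 the choice of a half does not matter and the Jacobi identity
  survives.\<close>

definition qf :: "'g list \<Rightarrow> ('g list \<Rightarrow> 'r::comm_ring_1) \<Rightarrow> ('g list \<Rightarrow> 'r) \<Rightarrow> 'r" where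
  "qf w F G = (\<Sum>i<length w. hsh F w (take i w) * G (drop i w)) +
              (\<Sum>i=1..<length w. hsh G w (take i w) * F (drop i w))"

text \<open>\<open>qA\<close> and \<open>qB\<close> are what remains of \<open>qf\<close> when one
  argument is a product: in \<open>qA\<close> one copy of w is cut twice and the other stays whole,
  in \<open>qB\<close> each copy is cut once. In the Jacobi identity the two kinds cancel for
  different reasons.\<close>

definition qA :: "'g list \<Rightarrow> ('g list \<Rightarrow> 'r::comm_ring_1) \<Rightarrow> ('g list \<Rightarrow> 'r) \<Rightarrow> ('g list \<Rightarrow> 'r) \<Rightarrow> 'r" where
  "qA w F G H = (\<Sum>j=1..<length w. \<Sum>i<j. hsh F w (take i w) * G (drop i (take j w)) * H (drop j w))"

definition qB :: "'g list \<Rightarrow> ('g list \<Rightarrow> 'r::comm_ring_1) \<Rightarrow> ('g list \<Rightarrow> 'r) \<Rightarrow> ('g list \<Rightarrow> 'r) \<Rightarrow> 'r" where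
  "qB w F G H = (\<Sum>j=1..<length w. \<Sum>i=1..<length w. hsh F (take i w) (take j w) * G (drop i w) * H (drop j w))"

text \<open>The product F w * G w is the term i = 0 of the first sum, which is why the two sums
  start at different indices. The rest is symmetric in F and G, so for F = G it is a double and only
  the square of F w survives modulo 2.\<close>

lemma qf_split:
  "w \<noteq> [] \<Longrightarrow> qf w F G = F w * G w + (\<Sum>i=1..<length w. hsh F w (take i w) * G (drop i w)) +
              (\<Sum>i=1..<length w. hsh G w (take i w) * F (drop i w))"
  unfolding qf_def by (subst lessThan_atLeast0, subst sum.atLeast_Suc_lessThan) (auto simp: hsh_Nil_right)

lemma qf_commute: "qf w F G = qf w G F"
  by (cases "w = []") (simp_all add: qf_split add_ac mult.commute, simp add: qf_def)

lemma qf_diff_left: "qf w (\<lambda>z. F z - F' z) G = qf w F G - qf w F' G"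
  by (simp add: qf_def hsh_diff algebra_simps sum.distrib sum_subtractf)

lemma qf_diff_right: "qf w F (\<lambda>z. G z - G' z) = qf w F G - qf w F G'"
  by (simp add: qf_commute[of w F] qf_diff_left)

lemma qf_0 [simp]: "qf w (\<lambda>z. 0) G = 0" "qf w G (\<lambda>z. 0) = 0"
  by (simp_all add: qf_def)

lemma qf_conv_first:
  assumes "G [] = 0" "H [] = 0"
  shows "(\<Sum>i<length w. hsh F w (take i w) * conv G H (drop i w)) = qA w F G H"
proof -
  have c: "conv G H (drop i w) = (\<Sum>j\<in>{j \<in> {1..<length w}. i < j}. G (drop i (take j w)) * H (drop j w))"
    if "i < length w" for i
  proof -
    have "conv G H (drop i w) = (\<Sum>l\<le>length w - i. G (take l (drop i w)) * H (drop l (drop i w)))"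
      by (simp add: conv_sum_split)
    also have "\<dots> = (\<Sum>j\<in>{i..length w}. G (drop i (take j w)) * H (drop j w))"
      by (rule sum.reindex_bij_witness[of _ "\<lambda>j. j - i" "\<lambda>l. l + i"])
         (use that in \<open>auto simp: take_drop add.commute\<close>)
    also have "\<dots> = (\<Sum>j\<in>{j \<in> {1..<length w}. i < j}. G (drop i (take j w)) * H (drop j w))"
    proof (rule sum.mono_neutral_right)
      show "\<forall>j\<in>{i..length w} - {j \<in> {1..<length w}. i < j}. G (drop i (take j w)) * H (drop j w) = 0"
      proof
        fix j assume "j \<in> {i..length w} - {j \<in> {1..<length w}. i < j}"
        then have "j = i \<or> j = length w" by auto
        then show "G (drop i (take j w)) * H (drop j w) = 0" using assms by auto
      qed
    qed auto
    finally show ?thesis .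
  qed
  have "(\<Sum>i<length w. hsh F w (take i w) * conv G H (drop i w)) =
      (\<Sum>i\<in>{..<length w}. \<Sum>j\<in>{j \<in> {1..<length w}. i < j}.
        hsh F w (take i w) * G (drop i (take j w)) * H (drop j w))"
    by (intro sum.cong refl) (simp add: c sum_distrib_left mult.assoc)
  also have "\<dots> = (\<Sum>j\<in>{1..<length w}. \<Sum>i\<in>{i \<in> {..<length w}. i < j}.
        hsh F w (take i w) * G (drop i (take j w)) * H (drop j w))"
    by (rule sum.swap_restrict) auto
  also have "\<dots> = qA w F G H"
    unfolding qA_def by (intro sum.cong refl) auto
  finally show ?thesis .
qed

text \<open>By \<open>hsh_conv\<close> both w and its prefix are cut. Where w is left whole this
  gives \<open>qA\<close>; where w is properly cut, primitivity of H forces the cut of the prefix to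
  its end, which gives \<open>qB\<close>.\<close>

lemma qf_conv_second:
  assumes "primitive G" "primitive H"
  shows "(\<Sum>i=1..<length w. hsh (conv G H) w (take i w) * F (drop i w)) = qA w G H F + qB w G H F"
proof -
  have "hsh (conv G H) w (take i w) =
      (\<Sum>b<i. hsh G w (take b w) * H (drop b (take i w))) +
      (\<Sum>a=1..<length w. hsh G (take a w) (take i w) * H (drop a w))" if "1 \<le> i" "i < length w" for i
  proof -
    let ?f = "\<lambda>a b. hsh G (take a w) (take b (take i w)) * sh H (drop a w) (drop b (take i w))"
    have H0: "H [] = 0" and G0: "G [] = 0" using assms by (auto simp: primitive_def)
    have in1: "(\<Sum>b\<le>i. ?f a b) = hsh G (take a w) (take i w) * H (drop a w)" if "a < length w" for a
    proof -
      have "(\<Sum>b\<le>i. ?f a b) = (\<Sum>b\<in>{i}. ?f a b)"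
        by (rule sum.mono_neutral_right)
           (use that \<open>i < length w\<close> assms(2) in \<open>auto simp: primitive_def\<close>)
      then show ?thesis by simp
    qed
    have "(\<Sum>b\<le>i. ?f (length w) b) = (\<Sum>b\<le>i. hsh G w (take b w) * H (drop b (take i w)))"
      by (intro sum.cong) (auto simp: min_def)
    also have "\<dots> = (\<Sum>b<i. hsh G w (take b w) * H (drop b (take i w)))"
    proof (rule sum.mono_neutral_right)
      show "\<forall>b\<in>{..i} - {..<i}. hsh G w (take b w) * H (drop b (take i w)) = 0"
      proof
        fix b assume "b \<in> {..i} - {..<i}"
        then have "drop b (take i w) = []" by auto
        then show "hsh G w (take b w) * H (drop b (take i w)) = 0" by (simp only: H0 mult_zero_right)
      qed
    qed auto
    finally have in2: "(\<Sum>b\<le>i. ?f (length w) b) = (\<Sum>b<i. hsh G w (take b w) * H (drop b (take i w)))" .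
    have "hsh (conv G H) w (take i w) = (\<Sum>a=1..length w. \<Sum>b\<le>i. ?f a b)"
      using that G0 by (simp add: hsh_conv min_def)
    also have "{1..length w} = insert (length w) {1..<length w}" using that by auto
    also have "(\<Sum>a\<in>\<dots>. \<Sum>b\<le>i. ?f a b) =
        (\<Sum>b\<le>i. ?f (length w) b) + (\<Sum>a=1..<length w. \<Sum>b\<le>i. ?f a b)" by simp
    finally show ?thesis using in1 in2 by simp
  qed
  then show ?thesis
    by (simp add: qA_def qB_def algebra_simps sum.distrib sum_distrib_left sum_distrib_right)
qed

lemma qf_conv:
  assumes "primitive G" "primitive H"
  shows "qf w F (conv G H) = qA w F G H + qA w G H F + qB w G H F"
  using assms unfolding qf_def
  by (simp add: qf_conv_second[simplified] qf_conv_first primitive_Nil add.assoc)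

text \<open>Exchanging the summation indices exchanges the arguments of the half-shuffle, and the
  two halves add up to a shuffle of nonempty words, on which F vanishes.\<close>

lemma qB_swap:
  assumes "primitive F"
  shows "qB w F G H + qB w F H G = 0"
proof -
  have "qB w F H G = (\<Sum>j=1..<length w. \<Sum>i=1..<length w. hsh F (take j w) (take i w) * H (drop j w) * G (drop i w))"
    unfolding qB_def by (rule sum.swap)
  then have "qB w F G H + qB w F H G = (\<Sum>j=1..<length w. \<Sum>i=1..<length w.
      (hsh F (take i w) (take j w) + hsh F (take j w) (take i w)) * G (drop i w) * H (drop j w))"
    by (simp add: qB_def algebra_simps sum.distrib)
  also have "\<dots> = 0"
  proof (intro sum.neutral ballI)
    fix i j assume ij: "j \<in> {1..<length w}" "i \<in> {1..<length w}"
    then have "take i w \<noteq> []" "take j w \<noteq> []" by auto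
    then have "hsh F (take i w) (take j w) + hsh F (take j w) (take i w) = 0"
      using assms by (simp add: sh_eq_hsh[symmetric] primitive_def)
    then show "(hsh F (take i w) (take j w) + hsh F (take j w) (take i w)) * G (drop i w) * H (drop j w) = 0"
      by simp
  qed
  finally show ?thesis .
qed

lemma char2_diff:
  assumes "(2::'r::comm_ring_1) = 0" shows "(x::'r) + x = 0" "(x::'r) - y = x + y"
proof -
  show *: "x + x = 0" for x :: 'r using assms mult_2[of x] by simp
  show "(x::'r) - y = x + y" using *[of y] by (simp add: algebra_simps add_eq_0_iff)
qed

text \<open>After expansion \<open>qA w F G H\<close> occurs twice, from the product of G and H
  paired with F and from the product of F and G paired with H, and likewise for the other orders;
  these cancel modulo 2. The \<open>qB\<close> terms pair up by \<open>qB_swap\<close>.\<close>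

lemma qf_jacobi:
  fixes F G H :: "'g list \<Rightarrow> 'r::comm_ring_1"
  assumes two: "(2::'r) = 0" and p: "primitive F" "primitive G" "primitive H"
  shows "qf w F (\<lambda>z. conv G H z - conv H G z) + qf w H (\<lambda>z. conv F G z - conv G F z)
    + qf w G (\<lambda>z. conv H F z - conv F H z) = 0" (is "?L = 0")
proof -
  have s: "x + (x + y) = y" for x y :: 'r
    using char2_diff(1)[OF two, of x] by (simp add: add.assoc[symmetric])
  have e: "qf w F (\<lambda>z. conv G H z - conv H G z) = qf w F (conv G H) + qf w F (conv H G)"
    for F G H :: "'g list \<Rightarrow> 'r"
    unfolding qf_diff_right by (rule char2_diff(2)[OF two])
  have "?L = (qB w G H F + qB w G F H) + (qB w H G F + qB w H F G) + (qB w F H G + qB w F G H)"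
    using p by (simp add: e qf_conv add_ac s)
  then show ?thesis using p by (simp add: qB_swap)
qed

primrec lam :: "'g list \<Rightarrow> 'g mtree \<Rightarrow> 'r::comm_ring_1" where
  "lam w (Leaf g) = 0"
| "lam w (Br s t) = qf w (tau s) (tau t)"

lemma lam_bracket:
  fixes x y :: "'g mtree \<Rightarrow>\<^sub>0 int"
  shows "lin_val (lam w) (bracket x y) = (qf w (taux x) (taux y) :: 'r::comm_ring_1)"
proof -
  have "lin_val (lam w) (bracket (frag_of s) y) = (qf w (tau s) (taux y) :: 'r)" for s
    using subset_UNIV
    by (induction y rule: frag_induction)
       (auto simp: taux_diff bracket_diff_right qf_diff_right lin_val_diff)
  with subset_UNIV show ?thesis
    by (induction x rule: frag_induction)
       (auto simp: taux_diff bracket_diff_left qf_diff_left lin_val_diff)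
qed

text \<open>Symmetry of \<open>qf\<close> is antisymmetry in characteristic 2. Closure of the ideal
  under brackets is harmless because \<open>qf\<close> sees only tensor images, and elements of the
  ideal have image 0.\<close>

lemma lam_ideal:
  assumes two: "(2::'r::comm_ring_1) = 0" and "x \<in> lie_ideal S"
  shows "lin_val (lam w) x = (0::'r)"
  using assms(2)
proof induction
  case (antisym a b)
  show ?case
    by (simp add: lin_val_add lam_bracket qf_commute[of w "taux b"] char2_diff[OF two])
next
  case (jacobi a b c)
  show ?case
    by (simp add: lin_val_add lam_bracket taux_bracket qf_jacobi[OF two] primitive_taux)
qed (simp_all add: lin_val_add lin_val_minus lam_bracket taux_ideal)

text \<open>The two ring hypotheses hold for \<open>bit\<close>. By the first, the functional at
  [y,y] is the square of the coefficient of w; by the second, this square is the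
  coefficient.\<close>

lemma taux_eq_0_if_square_in_ideal:
  assumes two: "(2::'r::comm_ring_1) = 0" and sq: "\<And>c::'r. c * c = c"
    and "bracket y y \<in> lie_ideal S"
  shows "taux y w = (0::'r)"
proof (cases "w = []")
  case True
  then show ?thesis by (simp add: primitive_Nil primitive_taux)
next
  case False
  have "qf w (taux y) (taux y) = (0::'r)"
    using lam_ideal[OF two assms(3), of w] by (simp add: lam_bracket)
  then show ?thesis using False by (simp add: qf_split sq add.assoc char2_diff[OF two])
qed

subsection \<open>Lyndon words\<close>

lemma lexordp_iff_less: "ord_class.lexordp u v \<longleftrightarrow> u < v" for u v :: "nat list"
  by (simp add: lexordp_conv_lexord list_less_def)

lemma append_less_same [simp]: "u @ v < u @ w \<longleftrightarrow> v < w" for u v w :: "nat list"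
  by (induction u) auto

lemma less_append_self: "v \<noteq> [] \<Longrightarrow> u < u @ v" for u v :: "nat list"
  using append_less_same[of u "[]" v] by (cases v) auto

lemma le_append_self: "u \<le> u @ v" for u v :: "nat list"
  using less_append_self[of v u] by (cases "v = []") auto

text \<open>Appending letters can reverse a comparison only if the smaller word is a prefix of the
  larger one.\<close>

lemma less_list_cases:
  assumes "(u :: nat list) < v"
  shows "(\<exists>q. v = u @ q) \<or> (\<forall>a b. u @ a < v @ b)"
  using assms
proof (induction u arbitrary: v)
  case (Cons x u)
  then show ?case by (cases v) fastforce+
qed auto

lemma less_append_if_longer:
  assumes "(u :: nat list) < v" "length v \<le> length u"
  shows "u @ a < v @ b"
proof -
  have "v \<noteq> u @ q" for q using assms by auto
  then show ?thesis using less_list_cases[OF assms(1)] by blast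
qed

lemma append_less_append_iff:
  "length a = length b \<Longrightarrow> a @ c < b @ d \<longleftrightarrow> a < b \<or> a = b \<and> c < d" for a b c d :: "nat list"
  by (induction a b rule: list_induct2) auto

lemma append_le_append_iff:
  "length a = length b \<Longrightarrow> a @ c \<le> b @ d \<longleftrightarrow> a < b \<or> a = b \<and> c \<le> d" for a b c d :: "nat list"
  by (induction a b rule: list_induct2) auto

lemma lyndon_rotation:
  "lyndon w \<longleftrightarrow> w \<noteq> [] \<and> (\<forall>p s. w = p @ s \<longrightarrow> p \<noteq> [] \<longrightarrow> s \<noteq> [] \<longrightarrow> w < s @ p)"
proof
  assume l: "lyndon w"
  show "w \<noteq> [] \<and> (\<forall>p s. w = p @ s \<longrightarrow> p \<noteq> [] \<longrightarrow> s \<noteq> [] \<longrightarrow> w < s @ p)"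
  proof (intro conjI allI impI)
    fix p s assume "w = p @ s" "p \<noteq> []" "s \<noteq> []"
    then show "w < s @ p"
      using l[unfolded lyndon_def lexordp_iff_less, THEN conjunct2, rule_format, of "length p"]
      by (simp add: rotate_append)
  qed (use l in \<open>simp add: lyndon_def\<close>)
next
  assume r: "w \<noteq> [] \<and> (\<forall>p s. w = p @ s \<longrightarrow> p \<noteq> [] \<longrightarrow> s \<noteq> [] \<longrightarrow> w < s @ p)"
  then show "lyndon w"
    unfolding lyndon_def lexordp_iff_less
    by (auto simp: rotate_drop_take intro!: r[THEN conjunct2, rule_format])
qed

text \<open>Suffixes, unlike rotations, behave well under concatenation. Suppose w = p s and s < w.
  If w = s q, the rotations s p and q s give both q < p and p < q; otherwise s < w persists after
  appending p to s.\<close>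

lemma lyndon_suffix:
  "lyndon w \<longleftrightarrow> w \<noteq> [] \<and> (\<forall>p s. w = p @ s \<longrightarrow> p \<noteq> [] \<longrightarrow> s \<noteq> [] \<longrightarrow> w < s)"
proof
  assume l: "lyndon w"
  have "w < s" if w: "w = p @ s" "p \<noteq> []" "s \<noteq> []" for p s
  proof (rule ccontr)
    assume "\<not> w < s"
    with w have "s < w" by (metis append_self_conv2 linorder_neqE)
    have sp: "w < s @ p" using l w unfolding lyndon_rotation by blast
    from less_list_cases[OF \<open>s < w\<close>] show False
    proof
      assume "\<exists>q. w = s @ q"
      then obtain q where q: "w = s @ q" by blast
      have len: "length p = length q" using w(1) q by (metis add_right_cancel length_append add.commute)
      have "q \<noteq> []" using len w by auto
      have "q < p" using sp q by simp
      moreover have "w < q @ s" using l q \<open>s \<noteq> []\<close> \<open>q \<noteq> []\<close> unfolding lyndon_rotation by blast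
      then have "p < q" using w(1) len by (simp add: append_less_append_iff)
      ultimately show False by simp
    next
      assume "\<forall>a b. s @ a < w @ b"
      then have "s @ p < w" by (metis append_Nil2)
      with sp show False by simp
    qed
  qed
  then show "w \<noteq> [] \<and> (\<forall>p s. w = p @ s \<longrightarrow> p \<noteq> [] \<longrightarrow> s \<noteq> [] \<longrightarrow> w < s)"
    using l by (simp add: lyndon_def)
next
  assume r: "w \<noteq> [] \<and> (\<forall>p s. w = p @ s \<longrightarrow> p \<noteq> [] \<longrightarrow> s \<noteq> [] \<longrightarrow> w < s)"
  show "lyndon w"
    unfolding lyndon_rotation
  proof (intro conjI allI impI)
    fix p s assume w: "w = p @ s" "p \<noteq> []" "s \<noteq> []"
    then have "w < s" using r by blast
    then show "w < s @ p" using w less_append_if_longer[of w s "[]" p] by simp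
  qed (use r in simp)
qed

lemma lyndon_less_suffix: "lyndon (p @ s) \<Longrightarrow> p \<noteq> [] \<Longrightarrow> s \<noteq> [] \<Longrightarrow> p @ s < s"
  by (auto simp: lyndon_suffix)

lemma lyndon_nonempty: "lyndon w \<Longrightarrow> w \<noteq> []"
  by (simp add: lyndon_def)

lemma not_lyndon_Nil [simp]: "\<not> lyndon []"
  by (simp add: lyndon_def)

lemma lyndon_singleton [simp]: "lyndon [c]"
  by (auto simp: lyndon_def)

lemma lyndon_append:
  assumes u: "lyndon u" and v: "lyndon v" and uv: "u < v"
  shows "lyndon (u @ v)"
proof -
  have ne: "u \<noteq> []" "v \<noteq> []" using u v by (auto simp: lyndon_nonempty)
  \<comment> \<open>If v = u q, cancelling u reduces the claim to v < q, the suffix criterion for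
    v.\<close>
  have less: "u @ v < v"
    using less_list_cases[OF uv]
  proof
    assume "\<exists>q. v = u @ q"
    then obtain q where q: "v = u @ q" by blast
    with uv have "q \<noteq> []" by auto
    then have "v < q" using v q ne lyndon_less_suffix by blast
    then show ?thesis using q by simp
  next
    assume "\<forall>a b. u @ a < v @ b"
    then show ?thesis by (metis append_Nil2)
  qed
  show ?thesis
    unfolding lyndon_suffix
  proof (intro conjI allI impI)
    fix p s assume ps: "u @ v = p @ s" "p \<noteq> []" "s \<noteq> []"
    then consider t where "u = p @ t" "s = t @ v" | t where "p = u @ t" "v = t @ s"
      by (auto simp: append_eq_append_conv2)
    then show "u @ v < s"
    proof cases
      case 1
      show ?thesis
      proof (cases "t = []")
        case False
        then have "u < t" using u 1 ps lyndon_less_suffix by blast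
        then show ?thesis using 1 less_append_if_longer[of u t] by simp
      qed (use 1 less in simp)
    next
      case 2
      show ?thesis
      proof (cases "t = []")
        case False
        then have "v < s" using v 2 ps lyndon_less_suffix by blast
        then show ?thesis using less by simp
      qed (use 2 less in simp)
    qed
  qed (use ne in simp)
qed

section \<open>Factorisation into nonincreasing Lyndon words and the standard factorisation\<close>

lemma lyndon_factorization_Cons:
  assumes "lyndon l" "\<forall>m\<in>set ms. lyndon m" "sorted_wrt (\<ge>) ms"
  shows "\<exists>ms'. concat ms' = l @ concat ms \<and> (\<forall>m\<in>set ms'. lyndon m) \<and> sorted_wrt (\<ge>) ms'"
  using assms
proof (induction ms arbitrary: l)
  case Nil
  then show ?case by (intro exI[of _ "[l]"]) auto
next
  case (Cons m ms)
  show ?case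
  proof (cases "l < m")
    case True
    then have "lyndon (l @ m)" using Cons.prems lyndon_append by auto
    from Cons.IH[OF this] Cons.prems show ?thesis by auto
  next
    case False
    then show ?thesis using Cons.prems
      by (intro exI[of _ "l # m # ms"]) (auto simp: not_less)
  qed
qed

lemma lyndon_factorization:
  "\<exists>ms. concat ms = w \<and> (\<forall>m\<in>set ms. lyndon m) \<and> sorted_wrt (\<ge>) ms"
proof (induction w)
  case (Cons c w)
  then obtain ms where "concat ms = w" "\<forall>m\<in>set ms. lyndon m" "sorted_wrt (\<ge>) ms" by blast
  then show ?case using lyndon_factorization_Cons[of "[c]" ms] by auto
qed (auto intro: exI[of _ "[]"])

lemma lyndon_first_last_factor:
  assumes "w \<noteq> []"
  obtains l r p m where "w = l @ r" "w = p @ m" "lyndon l" "lyndon m" "m \<le> l"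
    "r = [] \<or> p \<noteq> []" "r = [] \<longrightarrow> lyndon w"
proof -
  obtain ms where ms: "concat ms = w" "\<forall>m\<in>set ms. lyndon m" "sorted_wrt (\<ge>) ms"
    using lyndon_factorization by blast
  then obtain l ms' where l: "ms = l # ms'" using assms by (cases ms) auto
  show thesis
  proof (cases ms' rule: rev_cases)
    case Nil
    then have "w = l" "lyndon l" using ms l by auto
    then show thesis by (intro that[of l "[]" "[]" l]) auto
  next
    case (snoc ms'' m)
    have "lyndon m" using ms(2) l snoc by auto
    then have "m \<noteq> []" by (rule lyndon_nonempty)
    moreover have "l \<noteq> []" using ms(2) l by (auto simp: lyndon_nonempty)
    moreover have "w = l @ concat ms'' @ m" "m \<le> l" "lyndon l" using ms l snoc by auto
    ultimately show thesis
      using \<open>lyndon m\<close> by (intro that[of l "concat ms'' @ m" "l @ concat ms''" m]) auto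
  qed
qed

text \<open>If s is not Lyndon, let l and m be its first and last Lyndon factors. Then p < p s < m
  \<le> l, so p l is a Lyndon proper prefix longer than p.\<close>

lemma longest_lyndon_prefix_complement:
  assumes w: "lyndon (p @ s)" and p: "lyndon p" and "s \<noteq> []"
    and max: "\<And>p' s'. p @ s = p' @ s' \<Longrightarrow> s' \<noteq> [] \<Longrightarrow> lyndon p' \<Longrightarrow> length p' \<le> length p"
  shows "lyndon s"
proof -
  obtain l r q m where s: "s = l @ r" "s = q @ m" "lyndon l" "lyndon m" "m \<le> l"
    "r = [] \<or> q \<noteq> []" "r = [] \<longrightarrow> lyndon s"
    by (rule lyndon_first_last_factor[OF \<open>s \<noteq> []\<close>])
  have ne: "p \<noteq> []" "l \<noteq> []" "m \<noteq> []" using p s by (auto simp: lyndon_nonempty)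
  show ?thesis
  proof (cases "r = []")
    case False
    have "p < p @ s" using \<open>s \<noteq> []\<close> by (rule less_append_self)
    also have "\<dots> < m" using w s(2) ne lyndon_less_suffix[of "p @ q" m] by simp
    also have "m \<le> l" by fact
    finally have "lyndon (p @ l)" using p s by (intro lyndon_append)
    then have "length (p @ l) \<le> length p" using max[of "p @ l" r] s(1) False by simp
    then show ?thesis using ne by simp
  qed (use s in simp)
qed

text \<open>The longest proper Lyndon prefix has a Lyndon complement and is smaller than it, so the
  extra conditions in the definition do not lower the maximum. Hence the last clause bounds all
  proper Lyndon prefixes.\<close>

lemma std_split:
  assumes w: "lyndon w" and len: "length w > 1"
  shows "0 < std_split w" "std_split w < length w" "lyndon (take (std_split w) w)"
    "lyndon (drop (std_split w) w)" "take (std_split w) w < drop (std_split w) w"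
    "\<And>p s. w = p @ s \<Longrightarrow> s \<noteq> [] \<Longrightarrow> lyndon p \<Longrightarrow> length p \<le> std_split w"
proof -
  define P where "P n \<longleftrightarrow> 0 < n \<and> n < length w \<and> lyndon (take n w)" for n
  define n where "n = (GREATEST n. P n)"
  have "P 1" using len by (cases w) (auto simp: P_def)
  moreover have b: "P m \<Longrightarrow> m \<le> length w" for m by (auto simp: P_def)
  ultimately have Pn: "P n" unfolding n_def by (rule GreatestI_nat)
  have max: "m \<le> n" if "P m" for m
    unfolding n_def using that b by (rule Greatest_le_nat)
  have ly: "lyndon (drop n w)"
  proof (rule longest_lyndon_prefix_complement)
    show "lyndon (take n w @ drop n w)" using w by simp
    show "lyndon (take n w)" "drop n w \<noteq> []" using Pn by (auto simp: P_def)
    fix p s assume "take n w @ drop n w = p @ s" "s \<noteq> []" "lyndon p"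
    then have "P (length p)" by (auto simp: P_def lyndon_nonempty)
    then show "length p \<le> length (take n w)" using max Pn by (auto simp: P_def)
  qed
  have "take n w < take n w @ drop n w"
    by (rule less_append_self) (use Pn in \<open>auto simp: P_def\<close>)
  also have "\<dots> < drop n w"
    by (rule lyndon_less_suffix) (use Pn w in \<open>auto simp: P_def\<close>)
  finally have less: "take n w < drop n w" .
  have "std_split w = n"
    unfolding std_split_def lexordp_iff_less
  proof (rule Greatest_equality)
    show "0 < n \<and> n < length w \<and> lyndon (take n w) \<and> lyndon (drop n w) \<and> take n w < drop n w"
      using Pn ly less by (simp add: P_def)
  qed (use max in \<open>auto simp: P_def\<close>)
  then show "0 < std_split w" "std_split w < length w" "lyndon (take (std_split w) w)"
    "lyndon (drop (std_split w) w)" "take (std_split w) w < drop (std_split w) w"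
    using Pn ly less by (auto simp: P_def)
  fix p s assume "w = p @ s" "s \<noteq> []" "lyndon p"
  then have "P (length p)" by (auto simp: P_def lyndon_nonempty)
  then show "length p \<le> std_split w" using max \<open>std_split w = n\<close> by simp
qed

text \<open>Suppose the left factor were u p with p a nonempty proper prefix of v, and let l and m
  be the first and last Lyndon factors of p. As a Lyndon prefix of v, l is a prefix of the left
  factor of v, so l \<le> u < u p. But m is a proper suffix of the Lyndon word u p, so u p < m \<le>
  l.\<close>

lemma std_split_append:
  assumes u: "lyndon u" and v: "lyndon v" and uv: "u < v"
    and std: "length v > 1 \<Longrightarrow> take (std_split v) v \<le> u"
  shows "std_split (u @ v) = length u"
proof (rule ccontr)
  assume neq: "std_split (u @ v) \<noteq> length u"
  have ly: "lyndon (u @ v)" using u v uv by (rule lyndon_append)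
  have ne: "u \<noteq> []" "v \<noteq> []" using u v by (auto simp: lyndon_nonempty)
  then have len: "length (u @ v) > 1" by (cases u; cases v) auto
  let ?n = "std_split (u @ v)"
  have "length u \<le> ?n" using std_split(6)[OF ly len] u ne by blast
  with neq have gt: "length u < ?n" by simp
  define p where "p = take (?n - length u) v"
  define p' where "p' = drop (?n - length u) v"
  have lt: "?n < length u + length v" using std_split(2)[OF ly len] by simp
  have v_eq: "v = p @ p'" by (simp add: p_def p'_def)
  have p_ne: "p \<noteq> []" "p' \<noteq> []" using gt lt by (auto simp: p_def p'_def)
  have up: "lyndon (u @ p)" using std_split(3)[OF ly len] gt by (simp add: p_def)
  have len_v: "length v > 1" using v_eq p_ne by (cases p; cases p') auto
  obtain l r q m where s: "p = l @ r" "p = q @ m" "lyndon l" "lyndon m" "m \<le> l"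
    by (rule lyndon_first_last_factor[OF p_ne(1)])
  have "length l \<le> std_split v" using std_split(6)[OF v len_v, of l "r @ p'"] v_eq s p_ne by simp
  then have "take (std_split v) v = l @ take (std_split v - length l) (r @ p')"
    using v_eq s(1) by simp
  then have "l \<le> take (std_split v) v" by (simp add: le_append_self)
  also have "\<dots> \<le> u" using std len_v by simp
  also have "u < u @ p" using p_ne by (simp add: less_append_self)
  also have "u @ p < m"
    using lyndon_less_suffix[of "u @ q" m] up s ne by (auto simp: lyndon_nonempty)
  finally show False using s(5) by simp
qed

section \<open>Powers of Lyndon words\<close>

lemma prefix_of_power_suffix:
  assumes "p @ r = concat (replicate n u)" "p \<noteq> []"
  shows "\<exists>q s z. s \<noteq> [] \<and> p = q @ s \<and> u = s @ z"
  using assms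
proof (induction n arbitrary: p)
  case (Suc n)
  from Suc.prems(1) consider t where "u = p @ t" | t where "p = u @ t" "t @ r = concat (replicate n u)"
    by (auto simp: append_eq_append_conv2)
  then show ?case
  proof cases
    case 1
    then show ?thesis using Suc.prems by (intro exI[of _ "[]"] exI[of _ p] exI[of _ t]) auto
  next
    case 2
    show ?thesis
    proof (cases "t = []")
      case True
      then show ?thesis using 2 Suc.prems by (intro exI[of _ "[]"] exI[of _ p]) auto
    next
      case False
      with Suc.IH[OF 2(2)] obtain q s z where "s \<noteq> []" "t = q @ s" "u = s @ z" by blast
      then show ?thesis using 2(1) by (intro exI[of _ "u @ q"] exI[of _ s] exI[of _ z]) auto
    qed
  qed
qed simp

text \<open>If u were shorter than v, then v would be a prefix of a power of u and end in a nonempty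
  prefix s of u. As a proper suffix of v, s exceeds v; as a prefix of u, hence of v, it does
  not.\<close>

lemma lyndon_power_eq:
  assumes u: "lyndon u" and v: "lyndon v" and "n > 0" "m > 0"
    and eq: "concat (replicate n u) = concat (replicate m v)"
  shows "u = v"
proof -
  have wlog: "\<not> length u < length v"
    if u: "lyndon u" and v: "lyndon v" and pos: "n > 0" "m > 0"
      and eq: "concat (replicate n u) = concat (replicate m v)" for u v n m
  proof
    assume len: "length u < length v"
    obtain n' m' where nm: "n = Suc n'" "m = Suc m'" using pos by (auto simp: gr0_conv_Suc)
    then have eq': "u @ concat (replicate n' u) = v @ concat (replicate m' v)" using eq by simp
    have "u = take (length u) v"
      using arg_cong[OF eq', of "take (length u)"] len by simp
    then obtain t where t: "v = u @ t" by (metis append_take_drop_id)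
    have "v @ concat (replicate m' v) = concat (replicate n u)" using eq' nm by simp
    from prefix_of_power_suffix[OF this lyndon_nonempty[OF v]]
    obtain q s z where s: "s \<noteq> []" "v = q @ s" "u = s @ z" by blast
    have "q \<noteq> []" using s len by auto
    then have "v < s" using v s lyndon_less_suffix by blast
    moreover have "s \<le> v" using s t le_append_self[of s "z @ t"] by simp
    ultimately show False by simp
  qed
  have "length u = length v" using wlog[OF assms] wlog[OF v u assms(4,3) eq[symmetric]] by simp
  moreover obtain n' m' where "n = Suc n'" "m = Suc m'" using assms(3,4) by (auto simp: gr0_conv_Suc)
  ultimately show ?thesis using eq by simp
qed

subsection \<open>Bracketings of labelled Lyndon words\<close>

declare phi_pos.simps [simp del]

text \<open>Carrying the labels in the word instead of referring to positions makes bracketing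
  compatible with concatenation, which the rewriting and the leading terms both need.\<close>

definition word_tree :: "(nat \<times> 'a) list \<Rightarrow> (nat \<times> 'a) mtree" where
  "word_tree W = map_mtree (\<lambda>p. W ! p) (phi_pos 0 (map fst W))"

lemma phi_pos_short: "length w \<le> 1 \<Longrightarrow> phi_pos off w = Leaf off"
  by (subst phi_pos.simps) (simp add: Let_def)

lemma phi_pos_split:
  assumes "0 < std_split w" "std_split w < length w"
  shows "phi_pos off w = Br (phi_pos off (take (std_split w) w)) (phi_pos (off + std_split w) (drop (std_split w) w))"
  using assms by (subst phi_pos.simps) (simp add: Let_def)

lemma phi_pos_degenerate:
  assumes "\<not> (0 < std_split w \<and> std_split w < length w)"
  shows "phi_pos off w = Leaf off"
  using assms by (subst phi_pos.simps) (simp add: Let_def)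

text \<open>Positions are absolute, so the subtree of a right factor is a translate of the tree of
  that factor alone. Words without a usable split give a leaf, so the induction covers all
  words.\<close>

lemma phi_pos_shift: "phi_pos (a + off) w = map_mtree ((+) a) (phi_pos off w)"
proof (induction "length w" arbitrary: w off rule: less_induct)
  case less
  show ?case
  proof (cases "0 < std_split w \<and> std_split w < length w")
    case True
    then have "phi_pos (a + off) (take (std_split w) w) = map_mtree ((+) a) (phi_pos off (take (std_split w) w))"
      "phi_pos (a + (off + std_split w)) (drop (std_split w) w) =
        map_mtree ((+) a) (phi_pos (off + std_split w) (drop (std_split w) w))"
      by (auto intro!: less)
    then show ?thesis using True by (simp add: phi_pos_split add.assoc)
  qed (simp add: phi_pos_degenerate)
qed

lemma phi_pos_bounds: "w \<noteq> [] \<Longrightarrow> set_mtree (phi_pos off w) \<subseteq> {off..<off + length w}"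
proof (induction "length w" arbitrary: w off rule: less_induct)
  case less
  show ?case
  proof (cases "0 < std_split w \<and> std_split w < length w")
    case True
    have "set_mtree (phi_pos off (take (std_split w) w)) \<subseteq> {off..<off + length (take (std_split w) w)}"
      "set_mtree (phi_pos (off + std_split w) (drop (std_split w) w)) \<subseteq>
        {off + std_split w..<off + std_split w + length (drop (std_split w) w)}"
      by (rule less; use True less.prems in auto)+
    then show ?thesis using True by (auto simp: phi_pos_split)
  qed (use less.prems in \<open>simp add: phi_pos_degenerate\<close>)
qed

lemma word_tree_singleton [simp]: "word_tree [x] = Leaf x"
  by (simp add: word_tree_def phi_pos_short)

lemma word_tree_append:
  assumes "std_split (map fst (V @ W)) = length V" "V \<noteq> []" "W \<noteq> []"
  shows "word_tree (V @ W) = Br (word_tree V) (word_tree W)"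
proof -
  let ?w = "map fst (V @ W)"
  have "phi_pos 0 ?w = Br (phi_pos 0 (map fst V)) (phi_pos (length V) (map fst W))"
    using assms phi_pos_split[of ?w 0] by simp
  also have "phi_pos (length V) (map fst W) = map_mtree ((+) (length V)) (phi_pos 0 (map fst W))"
    using phi_pos_shift[of "length V" 0] by simp
  finally have "word_tree (V @ W) = Br (map_mtree (\<lambda>p. (V @ W) ! p) (phi_pos 0 (map fst V)))
      (map_mtree (\<lambda>p. (V @ W) ! (length V + p)) (phi_pos 0 (map fst W)))"
    by (simp add: word_tree_def mtree.map_comp comp_def)
  also have "map_mtree (\<lambda>p. (V @ W) ! p) (phi_pos 0 (map fst V)) = word_tree V"
    unfolding word_tree_def
    by (rule mtree.map_cong) (use phi_pos_bounds[of "map fst V" 0] assms in \<open>auto simp: nth_append\<close>)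
  also have "map_mtree (\<lambda>p. (V @ W) ! (length V + p)) (phi_pos 0 (map fst W)) = word_tree W"
    by (simp add: word_tree_def)
  finally show ?thesis .
qed

lemma word_tree_split:
  assumes "lyndon (map fst W)" "length W > 1"
  obtains A B where "W = A @ B" "A \<noteq> []" "B \<noteq> []" "lyndon (map fst A)" "lyndon (map fst B)"
    "map fst A < map fst B" "word_tree W = Br (word_tree A) (word_tree B)"
    "map fst A = take (std_split (map fst W)) (map fst W)"
proof -
  let ?n = "std_split (map fst W)"
  have len: "length (map fst W) > 1" using assms by simp
  note n = std_split[OF assms(1) len]
  show thesis
  proof (rule that[of "take ?n W" "drop ?n W"])
    show "word_tree W = Br (word_tree (take ?n W)) (word_tree (drop ?n W))"
      using assms(2) n(1,2) word_tree_append[of "take ?n W" "drop ?n W"] by force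
  qed (use n(1-5) in \<open>auto simp: take_map drop_map\<close>)
qed

lemma set_word_tree: "W \<noteq> [] \<Longrightarrow> set_mtree (word_tree W) \<subseteq> set W"
  using phi_pos_bounds[of "map fst W" 0] by (fastforce simp: word_tree_def mtree.set_map)

text \<open>The labelled word whose bracketing is \<open>beta_tree u ls\<close>. Sorting its labels
  by letter recovers the tensor \<open>ls\<close>.\<close>

definition fill :: "nat list \<Rightarrow> 'a list list \<Rightarrow> (nat \<times> 'a) list" where
  "fill u ls = map (\<lambda>p. (u ! p, ls ! (u ! p) ! occ u p)) [0..<length u]"

lemma length_fill [simp]: "length (fill u ls) = length u"
  by (simp add: fill_def)

lemma map_fst_fill [simp]: "map fst (fill u ls) = u"
  by (rule nth_equalityI) (auto simp: fill_def)

lemma beta_tree_eq: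
  assumes "u \<noteq> []" shows "beta_tree u ls = word_tree (fill u ls)"
  unfolding beta_tree_def word_tree_def map_fst_fill
  by (rule mtree.map_cong) (use phi_pos_bounds[of u 0] assms in \<open>auto simp: fill_def\<close>)

lemma fill_snoc: "fill (u @ [c]) ls = fill u ls @ [(c, ls ! c ! count_list u c)]"
  by (simp add: fill_def occ_def nth_append)

lemma fill_filter:
  "count_list u i \<le> length (ls ! i) \<Longrightarrow>
    map snd (filter (\<lambda>p. fst p = i) (fill u ls)) = take (count_list u i) (ls ! i)"
proof (induction u rule: rev_induct)
  case Nil
  then show ?case by (simp add: fill_def)
next
  case (snoc c u)
  then show ?case by (auto simp: fill_snoc take_Suc_conv_app_nth split: if_splits)
qed

lemma lyndon_BD:
  assumes "u \<in> lyndon_B m" "length m = k"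
  shows "lyndon u" "u \<noteq> []" "set u \<subseteq> {..<k}" "\<And>i. i < k \<Longrightarrow> count_list u i = m ! i"
  using assms by (auto simp: lyndon_B_def lyndon_nonempty)

lemma lyndon_B_unique:
  assumes "u \<in> lyndon_B m" "u \<in> lyndon_B m'" "length m = k" "length m' = k"
  shows "m = m'"
  using assms by (intro nth_equalityI) (auto simp: lyndon_B_def)

lemma fill_inj:
  assumes "u \<in> lyndon_B m" "length m = k"
    and ls: "ls \<in> tensor_basis k X m" "ls' \<in> tensor_basis k X m" and eq: "fill u ls = fill u ls'"
  shows "ls = ls'"
proof (rule nth_equalityI)
  show "length ls = length ls'" using ls by (simp add: tensor_basis_def)
  fix i assume "i < length ls"
  then have i: "i < k" using ls by (simp add: tensor_basis_def)
  then have *: "count_list u i = length (ls ! i)" "count_list u i = length (ls' ! i)"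
    using lyndon_BD(4)[OF assms(1,2)] ls by (auto simp: tensor_basis_def)
  show "ls ! i = ls' ! i" using fill_filter[of u i ls] fill_filter[of u i ls'] * eq by simp
qed

lemma occ_less: "p < length u \<Longrightarrow> occ u p < count_list u (u ! p)"
  by (subst (2) id_take_nth_drop[of p u]) (auto simp: occ_def)

lemma fill_set:
  assumes "u \<in> lyndon_B m" "length m = k" "ls \<in> tensor_basis k X m"
  shows "set (fill u ls) \<subseteq> sum_basis k X"
proof
  fix x assume "x \<in> set (fill u ls)"
  then obtain p where p: "p < length u" "x = (u ! p, ls ! (u ! p) ! occ u p)"
    by (auto simp: fill_def)
  have k: "u ! p < k" using lyndon_BD(3)[OF assms(1,2)] p by (meson lessThan_iff nth_mem subsetD)
  then have "length (ls ! (u ! p)) = count_list u (u ! p)" "set (ls ! (u ! p)) \<subseteq> X (u ! p)"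
    using assms lyndon_BD(4)[OF assms(1,2)] by (auto simp: tensor_basis_def)
  then show "x \<in> sum_basis k X"
    using p k occ_less[OF p(1)] by (auto simp: sum_basis_def)
qed

lemma fill_surj:
  assumes W: "set W \<subseteq> sum_basis k X" "lyndon (map fst W)"
  obtains m ls where "length m = k" "map fst W \<in> lyndon_B m" "ls \<in> tensor_basis k X m"
    "fill (map fst W) ls = W"
proof -
  define m where "m = map (count_list (map fst W)) [0..<k]"
  define ls where "ls = map (\<lambda>i. map snd (filter (\<lambda>p. fst p = i) W)) [0..<k]"
  have count: "count_list (map fst V) i = length (filter (\<lambda>p. fst p = i) V)" for V :: "(nat \<times> 'a) list" and i
    by (induction V) auto
  have fst_less: "fst p < k" if "p \<in> set W" for p using that W by (auto simp: sum_basis_def)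
  \<comment> \<open>The induction is over prefixes V of W: the index of the next label is the number
    of earlier occurrences in V, whereas the lists in \<open>ls\<close> are collected from all of
    W.\<close>
  have "fill (map fst V) ls = V" if "V @ V' = W" for V V'
    using that
  proof (induction V arbitrary: V' rule: rev_induct)
    case (snoc x V)
    then have "fst x < k" using fst_less[of x] by auto
    then have "ls ! fst x = map snd (filter (\<lambda>p. fst p = fst x) (V @ x # V'))"
      using snoc.prems by (simp add: ls_def)
    then have "ls ! fst x ! count_list (map fst V) (fst x) = snd x"
      by (simp add: count nth_append)
    then show ?case using snoc.IH[of "x # V'"] snoc.prems by (simp add: fill_snoc)
  qed (simp add: fill_def)
  from this[of W "[]"] have "fill (map fst W) ls = W" by simp
  moreover have "map fst W \<in> lyndon_B m"
    using W(2) fst_less by (auto simp: lyndon_B_def m_def)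
  moreover have "ls \<in> tensor_basis k X m"
    using W(1) by (auto simp: tensor_basis_def ls_def m_def count sum_basis_def)
  ultimately show thesis by (intro that[of m ls]) (simp_all add: m_def)
qed

subsection \<open>Surjectivity\<close>

text \<open>The span of G in the free Lie algebra, kept at the level of representatives.\<close>

definition modspan :: "'g set \<Rightarrow> 'g mtree set \<Rightarrow> ('g mtree \<Rightarrow>\<^sub>0 int) set" where
  "modspan S G = {x. \<exists>y\<in>FA G. x - y \<in> lie_ideal S}"

lemma modspan_of: "t \<in> G \<Longrightarrow> frag_of t \<in> modspan S G"
  by (auto simp: modspan_def intro!: bexI[of _ "frag_of t"] lie_ideal.zero)

lemma modspan_0: "0 \<in> modspan S G"
  by (auto simp: modspan_def intro!: bexI[of _ 0] lie_ideal.zero)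

lemma modspan_diff:
  assumes "x \<in> modspan S G" "y \<in> modspan S G" shows "x - y \<in> modspan S G"
proof -
  obtain a b where ab: "a \<in> FA G" "x - a \<in> lie_ideal S" "b \<in> FA G" "y - b \<in> lie_ideal S"
    using assms by (auto simp: modspan_def)
  with lie_ideal_diff[OF ab(2,4)] show ?thesis
    unfolding modspan_def by (auto intro!: bexI[of _ "a - b"] FA_diff simp: algebra_simps)
qed

lemma modspan_minus: "x \<in> modspan S G \<Longrightarrow> - x \<in> modspan S G"
  using modspan_diff[OF modspan_0, of x] by simp

lemma modspan_add: "x \<in> modspan S G \<Longrightarrow> y \<in> modspan S G \<Longrightarrow> x + y \<in> modspan S G"
  using modspan_diff[of x S G "- y"] modspan_minus[of y S G] by simp

lemma modspan_mono: "x \<in> modspan S G \<Longrightarrow> G \<subseteq> G' \<Longrightarrow> x \<in> modspan S G'"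
  by (auto simp: modspan_def intro: FA_mono)

lemma modspan_cong:
  assumes "x - y \<in> lie_ideal S" "y \<in> modspan S G" shows "x \<in> modspan S G"
proof -
  obtain a where "a \<in> FA G" "y - a \<in> lie_ideal S" using assms by (auto simp: modspan_def)
  moreover from this have "(x - y) + (y - a) \<in> lie_ideal S" using assms by (intro lie_ideal.add)
  ultimately show ?thesis by (auto simp: modspan_def)
qed

lemma modspan_bracket:
  assumes x: "x \<in> modspan S G" and y: "y \<in> modspan S H" and GH: "G \<subseteq> trees S" "H \<subseteq> trees S"
    and br: "\<And>s t. s \<in> G \<Longrightarrow> t \<in> H \<Longrightarrow> frag_of (Br s t) \<in> modspan S K"
  shows "bracket x y \<in> modspan S K"
proof -
  obtain a b where a: "a \<in> FA G" "x - a \<in> lie_ideal S" and b: "b \<in> FA H" "y - b \<in> lie_ideal S"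
    using x y by (auto simp: modspan_def)
  have FA: "a \<in> FA (trees S)" "b \<in> FA (trees S)" using a b GH by (auto intro: FA_mono)
  have "y \<in> FA (trees S)" using FA_add[OF lie_ideal_FA[OF b(2)] FA(2)] by simp
  then have "bracket x y - bracket a b \<in> lie_ideal S"
    using a b FA by (intro bracket_cong_ideal)
  moreover have "bracket a b \<in> modspan S K"
    using a(1) b(1) by (rule bilinear_induct) (auto intro: modspan_0 modspan_diff br)
  ultimately show ?thesis by (rule modspan_cong)
qed

lemma modspan_antisym:
  assumes "frag_of (Br t s) \<in> modspan S G" "s \<in> trees S" "t \<in> trees S"
  shows "frag_of (Br s t) \<in> modspan S G"
proof -
  have "bracket (frag_of s) (frag_of t) + bracket (frag_of t) (frag_of s) \<in> lie_ideal S"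
    using assms by (intro lie_ideal.antisym) auto
  then have "frag_of (Br s t) - - frag_of (Br t s) \<in> lie_ideal S" by simp
  then show ?thesis using assms(1) by (rule modspan_cong[OF _ modspan_minus])
qed

text \<open>Jacobi with two terms turned round by antisymmetry: bracketing with a is a derivation.
  This is the rewriting rule.\<close>

lemma jacobi_leibniz:
  assumes "a \<in> FA (trees S)" "b \<in> FA (trees S)" "c \<in> FA (trees S)"
  shows "bracket a (bracket b c) - (bracket (bracket a b) c + bracket b (bracket a c)) \<in> lie_ideal S"
proof -
  have "bracket a (bracket b c) + bracket c (bracket a b) + bracket b (bracket c a) \<in> lie_ideal S"
    using assms by (intro lie_ideal.jacobi)
  moreover have "bracket c (bracket a b) + bracket (bracket a b) c \<in> lie_ideal S"
    using assms by (intro lie_ideal.antisym) auto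
  moreover have "bracket b (bracket c a + bracket a c) \<in> lie_ideal S"
    using assms by (intro lie_ideal.brr lie_ideal.antisym)
  ultimately have "(bracket a (bracket b c) + bracket c (bracket a b) + bracket b (bracket c a))
     - (bracket c (bracket a b) + bracket (bracket a b) c) - bracket b (bracket c a + bracket a c) \<in> lie_ideal S"
    by (intro lie_ideal_diff)
  then show ?thesis by (simp add: bracket_add_right algebra_simps)
qed

section \<open>Lie monomials attached to a Lyndon word, graded by length\<close>

definition labelled :: "(nat \<times> 'a) set \<Rightarrow> nat list \<Rightarrow> (nat \<times> 'a) list set" where
  "labelled S u = {W. map fst W = u \<and> set W \<subseteq> S}"

text \<open>N is the number of letters after substitution; it is recorded because the outer
  induction of the rewriting runs on it.\<close>

definition gens_of :: "(nat \<times> 'a) set \<Rightarrow> nat list \<Rightarrow> nat \<Rightarrow> (nat \<times> 'a) mtree set" where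
  "gens_of S u N = {graft word_tree T |T. T \<in> trees (labelled S u) \<and> length u * leaves T = N}"

definition gens_above :: "(nat \<times> 'a) set \<Rightarrow> nat list \<Rightarrow> nat \<Rightarrow> (nat \<times> 'a) mtree set" where
  "gens_above S u N = (\<Union>w\<in>{w. lyndon w \<and> u < w}. gens_of S w N)"

lemma gens_aboveI:
  "lyndon w \<Longrightarrow> u < w \<Longrightarrow> T \<in> trees (labelled S w) \<Longrightarrow> length w * leaves T = N \<Longrightarrow>
    graft word_tree T \<in> gens_above S u N"
  by (auto simp: gens_above_def gens_of_def)

lemma gens_aboveE:
  assumes "s \<in> gens_above S u N"
  obtains w T where "lyndon w" "u < w" "T \<in> trees (labelled S w)" "length w * leaves T = N" "s = graft word_tree T"
  using assms by (auto simp: gens_above_def gens_of_def)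

lemma gens_above_mono: "u < w \<Longrightarrow> gens_above S w N \<subseteq> gens_above S u N"
  by (fastforce simp: gens_above_def)

lemma graft_word_tree_trees:
  assumes "lyndon w" "T \<in> trees (labelled S w)" shows "graft word_tree T \<in> trees S"
proof -
  have "word_tree W \<in> trees S" if "W \<in> labelled S w" for W
    using that set_word_tree[of W] lyndon_nonempty[OF assms(1)] by (auto simp: labelled_def trees_def)
  then show ?thesis using assms(2) by (rule graft_trees)
qed

lemma gens_above_trees: "gens_above S u N \<subseteq> trees S"
  by (auto elim!: gens_aboveE intro: graft_word_tree_trees)

lemma labelled_letters:
  assumes "T \<in> trees (labelled S w)" "\<And>p. p \<in> S \<Longrightarrow> fst p < k"
  shows "set w \<subseteq> {..<k}"
  using assms(1) by (induction T) (auto simp: labelled_def dest!: assms(2))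

text \<open>Rewriting strictly increases the smaller of the two Lyndon words, and there are only finitely
  many words of bounded length; this is what makes the induction well-founded.\<close>

lemma bracket_in_span_above:
  assumes S: "\<And>p. p \<in> S \<Longrightarrow> fst p < k"
  shows "lyndon u \<Longrightarrow> lyndon v \<Longrightarrow> u < v \<Longrightarrow> T1 \<in> trees (labelled S u) \<Longrightarrow> T2 \<in> trees (labelled S v) \<Longrightarrow>
    N = length u * leaves T1 + length v * leaves T2 \<Longrightarrow>
    frag_of (Br (graft word_tree T1) (graft word_tree T2)) \<in> modspan S (gens_above S u N)"
proof (induction N arbitrary: u v T1 T2 rule: less_induct)
  case (less N)
  note IHN = less.IH
  define up where "up u = {w. set w \<subseteq> {..<k} \<and> length w \<le> N \<and> u < w}" for u
  have fin: "finite (up u)" for u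
    by (rule finite_subset[OF _ finite_lists_length_le[of "{..<k}" N]]) (auto simp: up_def)
  from less.prems show ?case
  proof (induction "card (up u)" arbitrary: u v T1 T2 rule: less_induct)
    case less
    note u = \<open>lyndon u\<close>
    have IHu: "frag_of (Br (graft word_tree T1) (graft word_tree T2)) \<in> modspan S (gens_above S u N)"
      if "lyndon w" "lyndon w'" "w < w'" "T1 \<in> trees (labelled S w)" "T2 \<in> trees (labelled S w')"
        "N = length w * leaves T1 + length w' * leaves T2" "u < w" for w w' T1 T2
    proof -
      have "length w * 1 \<le> length w * leaves T1" by (intro mult_le_mono2) (simp add: Suc_leI)
      then have "length w \<le> N" unfolding that(6) mult_1_right by (rule trans_le_add1)
      then have "w \<in> up u" using that labelled_letters[OF that(4) S] by (auto simp: up_def)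
      then have "up w \<subset> up u" using \<open>u < w\<close> by (auto simp: up_def)
      then have "card (up w) < card (up u)" using fin by (intro psubset_card_mono)
      from less.hyps[OF this that(1-6)] show ?thesis
        using gens_above_mono[OF \<open>u < w\<close>] by (rule modspan_mono)
    qed
    \<comment> \<open>Both words exceed u, so the induction on the smaller word applies. For equal
      words the bracket is itself a monomial of that component.\<close>
    have closed: "frag_of (Br s t) \<in> modspan S (gens_above S u N)"
      if s: "s \<in> gens_above S u N1" and t: "t \<in> gens_above S u N2" and N: "N = N1 + N2" for s t N1 N2
    proof -
      obtain w T where w: "lyndon w" "u < w" "T \<in> trees (labelled S w)" "length w * leaves T = N1" "s = graft word_tree T"
        using s by (rule gens_aboveE)
      obtain w' T' where w': "lyndon w'" "u < w'" "T' \<in> trees (labelled S w')" "length w' * leaves T' = N2" "t = graft word_tree T'"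
        using t by (rule gens_aboveE)
      consider "w < w'" | "w' < w" | "w = w'" by (rule linorder_cases)
      then show ?thesis
      proof cases
        case 1
        then show ?thesis using IHu[of w w' T T'] w w' N by simp
      next
        case 2
        then have "frag_of (Br t s) \<in> modspan S (gens_above S u N)"
          using IHu[of w' w T' T] w w' N by simp
        then show ?thesis by (rule modspan_antisym) (use w w' in \<open>auto intro: graft_word_tree_trees\<close>)
      next
        case 3
        then have "graft word_tree (Br T T') \<in> gens_above S u N"
          using w w' N by (intro gens_aboveI) (auto simp: algebra_simps)
        then show ?thesis using w w' by (intro modspan_of) simp
      qed
    qed
    \<comment> \<open>By the derivation rule: [a,p] and [a,q] are assumed to be expressed above u,
      and then only brackets of two elements above u remain.\<close>
    have jac: "frag_of (Br a (Br p q)) \<in> modspan S (gens_above S u N)"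
      if "a \<in> trees S" "p \<in> gens_above S u Np" "q \<in> gens_above S u Nq"
        "frag_of (Br a p) \<in> modspan S (gens_above S u Nap)" "frag_of (Br a q) \<in> modspan S (gens_above S u Naq)"
        "N = Nap + Nq" "N = Np + Naq"
      for a p q Np Nq Nap Naq
    proof -
      have pq: "p \<in> trees S" "q \<in> trees S" using that gens_above_trees by blast+
      have "bracket (frag_of (Br a p)) (frag_of q) \<in> modspan S (gens_above S u N)"
        by (rule modspan_bracket[OF that(4) modspan_of[OF that(3)] gens_above_trees gens_above_trees
              closed[OF _ _ that(6)]])
      moreover have "bracket (frag_of p) (frag_of (Br a q)) \<in> modspan S (gens_above S u N)"
        by (rule modspan_bracket[OF modspan_of[OF that(2)] that(5) gens_above_trees gens_above_trees
              closed[OF _ _ that(7)]])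
      moreover have "frag_of (Br a (Br p q)) - (frag_of (Br (Br a p) q) + frag_of (Br p (Br a q))) \<in> lie_ideal S"
        using jacobi_leibniz[of "frag_of a" S "frag_of p" "frag_of q"] pq that(1) by simp
      ultimately show ?thesis by (auto intro: modspan_cong modspan_add)
    qed
    have len_u: "length u > 0" using u by (simp add: lyndon_nonempty)
    from less.prems show ?case
    proof (induction T1 arbitrary: v T2)
      \<comment> \<open>[[a,b],c] = [a,[b,c]] - [b,[a,c]]: the inner brackets have smaller total
        length, the outer ones a smaller left tree. The word on the right may change, so the
        structural induction keeps it arbitrary.\<close>
      case (Br s1 s2)
      let ?a = "graft word_tree s1" and ?b = "graft word_tree s2" and ?c = "graft word_tree T2"
      have tr: "?a \<in> trees S" "?b \<in> trees S" "?c \<in> trees S"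
        using Br.prems by (auto intro: graft_word_tree_trees)
      have step: "bracket (frag_of (graft word_tree s)) (frag_of (Br (graft word_tree s') ?c)) \<in> modspan S (gens_above S u N)"
        if ss: "s \<in> trees (labelled S u)" "s' \<in> trees (labelled S u)" "leaves s + leaves s' = leaves (Br s1 s2)"
          and IH: "\<And>v T2. lyndon v \<Longrightarrow> u < v \<Longrightarrow> T2 \<in> trees (labelled S v) \<Longrightarrow>
            N = length u * leaves s + length v * leaves T2 \<Longrightarrow>
            frag_of (Br (graft word_tree s) (graft word_tree T2)) \<in> modspan S (gens_above S u N)" for s s'
      proof -
        let ?N' = "length u * leaves s' + length v * leaves T2"
        have N: "N = length u * leaves s + ?N'"
          using Br.prems(6) ss(3) by (metis add.assoc add_mult_distrib2)
        then have "?N' < N" using len_u by simp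
        from IHN[OF this u _ _ ss(2) _ refl] Br.prems
        have "frag_of (Br (graft word_tree s') ?c) \<in> modspan S (gens_above S u ?N')" by blast
        then show ?thesis
        proof (rule modspan_bracket[OF modspan_of[OF singletonI]])
          show "{graft word_tree s} \<subseteq> trees S" using ss u by (auto intro: graft_word_tree_trees)
          fix x t assume "x \<in> {graft word_tree s}" "t \<in> gens_above S u ?N'"
          moreover from this(2) obtain w T where "lyndon w" "u < w" "T \<in> trees (labelled S w)"
            "length w * leaves T = ?N'" "t = graft word_tree T" by (rule gens_aboveE)
          ultimately show "frag_of (Br x t) \<in> modspan S (gens_above S u N)"
            using IH[of w T] N by simp
        qed (rule gens_above_trees)
      qed
      have "bracket (frag_of ?a) (frag_of (Br ?b ?c)) \<in> modspan S (gens_above S u N)"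
        by (rule step) (use Br in auto)
      moreover have "bracket (frag_of ?b) (frag_of (Br ?a ?c)) \<in> modspan S (gens_above S u N)"
        by (rule step) (use Br in auto)
      moreover have "frag_of (Br (Br ?a ?b) ?c) - (frag_of (Br ?a (Br ?b ?c)) - frag_of (Br ?b (Br ?a ?c))) \<in> lie_ideal S"
        using lie_ideal.neg[OF jacobi_leibniz[of "frag_of ?a" S "frag_of ?b" "frag_of ?c"]] tr
        by (simp add: algebra_simps)
      ultimately show ?case by (auto intro: modspan_cong modspan_diff)
    next
      case (Leaf W1)
      have W1: "map fst W1 = u" "set W1 \<subseteq> S" using Leaf.prems by (auto simp: labelled_def)
      let ?a = "word_tree W1"
      have a: "?a \<in> trees S" using Leaf.prems graft_word_tree_trees[of u "Leaf W1"] by simp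
      have rec: "frag_of (Br ?a (graft word_tree T)) \<in> modspan S (gens_above S u (length u + length w * leaves T))"
        if "lyndon w" "u < w" "T \<in> trees (labelled S w)" "length u + length w * leaves T < N" for w T
        using IHN[OF that(4) u that(1,2) Leaf.prems(4) that(3)] by simp
      show ?case
      proof (cases T2)
        case (Br t1 t2)
        have t: "t1 \<in> trees (labelled S v)" "t2 \<in> trees (labelled S v)" using Leaf.prems Br by auto
        have N: "N = length u + length v * leaves t1 + length v * leaves t2"
          using Leaf.prems Br by (simp add: algebra_simps)
        have lv: "length v > 0" using Leaf.prems by (simp add: lyndon_nonempty)
        have "frag_of (Br ?a (Br (graft word_tree t1) (graft word_tree t2))) \<in> modspan S (gens_above S u N)"
          by (rule jac[OF a gens_aboveI[OF _ _ t(1) refl] gens_aboveI[OF _ _ t(2) refl]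
                rec[OF _ _ t(1)] rec[OF _ _ t(2)]])
             (use Leaf.prems N lv in auto)
        then show ?thesis using Br by simp
      next
        case (Leaf W2)
        have W2: "map fst W2 = v" "set W2 \<subseteq> S" using Leaf.prems Leaf by (auto simp: labelled_def)
        have ne: "W1 \<noteq> []" "W2 \<noteq> []" using W1 W2 Leaf.prems(1,2) by (auto simp: lyndon_nonempty)
        have N: "N = length u + length v" using Leaf.prems Leaf by simp
        show ?thesis
        proof (cases "length v > 1 \<and> u < take (std_split v) v")
          \<comment> \<open>Here v is a letter or its left factor is at most u, so u v splits at u
            and the bracket is already a bracketed Lyndon word; it lies above u because u < u
            v.\<close>
          case False
          then have "std_split (u @ v) = length u"
            using Leaf.prems(1-3) by (intro std_split_append) auto
          then have "word_tree (W1 @ W2) = Br ?a (word_tree W2)"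
            using W1 W2 ne by (intro word_tree_append) auto
          moreover have "graft word_tree (Leaf (W1 @ W2)) \<in> gens_above S u N"
            using W1 W2 Leaf.prems(1-3) N lyndon_nonempty[of v]
            by (intro gens_aboveI[of "u @ v"]) (auto simp: labelled_def lyndon_append less_append_self)
          ultimately show ?thesis using Leaf by (intro modspan_of) simp
        next
          \<comment> \<open>Both factors of v exceed u, so they can play the part of the two
            subtrees in the derivation rule.\<close>
          case True
          obtain A B where AB: "W2 = A @ B" "A \<noteq> []" "B \<noteq> []" "lyndon (map fst A)" "lyndon (map fst B)"
            "map fst A < map fst B" "word_tree W2 = Br (word_tree A) (word_tree B)"
            "map fst A = take (std_split v) v"
            using word_tree_split[of W2] W2 True Leaf.prems(2) by (metis length_map)
          have uA: "u < map fst A" using True AB by simp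
          have uB: "u < map fst B" using uA AB(6) by (rule less_trans)
          have t: "Leaf A \<in> trees (labelled S (map fst A))" "Leaf B \<in> trees (labelled S (map fst B))"
            using W2 AB(1) by (auto simp: labelled_def)
          have lv: "length v = length A + length B" using W2 AB(1) by auto
          have "frag_of (Br ?a (Br (graft word_tree (Leaf A)) (graft word_tree (Leaf B)))) \<in> modspan S (gens_above S u N)"
            by (rule jac[OF a gens_aboveI[OF _ _ t(1) refl] gens_aboveI[OF _ _ t(2) refl]
                rec[OF _ _ t(1)] rec[OF _ _ t(2)]])
               (use uA uB AB(2-5) N lv in auto)
          then show ?thesis using Leaf AB(7) by simp
        qed
      qed
    qed
  qed
qed

lemma tree_in_span:
  assumes S: "\<And>p. p \<in> S \<Longrightarrow> fst p < k" and "t \<in> trees S"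
  shows "frag_of t \<in> modspan S {graft word_tree T |w T. lyndon w \<and> T \<in> trees (labelled S w)}"
    (is "_ \<in> modspan S ?G")
  using assms(2)
proof (induction t)
  case (Leaf p)
  then have "graft word_tree (Leaf [p]) \<in> ?G"
    by (intro CollectI exI[of _ "[fst p]"] exI[of _ "Leaf [p]"]) (auto simp: labelled_def)
  then show ?case by (intro modspan_of) simp
next
  case (Br s t)
  have GS: "?G \<subseteq> trees S" by (auto intro: graft_word_tree_trees)
  have above: "gens_above S u N \<subseteq> ?G" for u N by (auto elim!: gens_aboveE)
  have *: "frag_of (Br (graft word_tree T) (graft word_tree T')) \<in> modspan S ?G"
    if "lyndon w" "T \<in> trees (labelled S w)" "lyndon w'" "T' \<in> trees (labelled S w')" "w < w'" for w w' T T'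
    using modspan_mono[OF bracket_in_span_above[OF S that(1,3,5,2,4) refl] above] .
  have "bracket (frag_of s) (frag_of t) \<in> modspan S ?G"
  proof (rule modspan_bracket[OF _ _ GS GS])
    fix a b assume "a \<in> ?G" "b \<in> ?G"
    then obtain w T w' T' where w: "lyndon w" "T \<in> trees (labelled S w)" "a = graft word_tree T"
      and w': "lyndon w'" "T' \<in> trees (labelled S w')" "b = graft word_tree T'" by blast
    consider "w < w'" | "w' < w" | "w = w'" by (rule linorder_cases)
    then show "frag_of (Br a b) \<in> modspan S ?G"
    proof cases
      case 1
      then show ?thesis using * w w' by blast
    next
      case 2
      then have "frag_of (Br b a) \<in> modspan S ?G" using * w w' by blast
      then show ?thesis by (rule modspan_antisym) (use w w' in \<open>auto intro: graft_word_tree_trees\<close>)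
    next
      case 3
      then have "graft word_tree (Br T T') \<in> ?G" using w w'
        by (intro CollectI exI[of _ w] exI[of _ "Br T T'"]) auto
      then show ?thesis using w w' by (intro modspan_of) simp
    qed
  qed (use Br in auto)
  then show ?case by simp
qed

section \<open>Tensor basis elements as labelled words\<close>

lemma graft_map_mtree: "graft f (map_mtree g t) = graft (\<lambda>x. f (g x)) t"
  by (induction t) auto

lemma graft_cong: "(\<And>x. x \<in> set_mtree t \<Longrightarrow> f x = g x) \<Longrightarrow> graft f t = graft g t"
  by (induction t) auto

lemma trees_image:
  assumes "T \<in> trees (f ` A)" shows "\<exists>t\<in>trees A. T = map_mtree f t"
  using assms
proof (induction T)
  case (Leaf x)
  then obtain a where "a \<in> A" "x = f a" by auto
  then show ?case by (intro bexI[of _ "Leaf a"]) auto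
next
  case (Br T1 T2)
  then obtain t1 t2 where "t1 \<in> trees A" "T1 = map_mtree f t1" "t2 \<in> trees A" "T2 = map_mtree f t2" by auto
  then show ?case by (intro bexI[of _ "Br t1 t2"]) auto
qed

lemma labelled_eq_image_fill:
  assumes "u \<in> lyndon_B m" "length m = k"
  shows "labelled (sum_basis k X) u = fill u ` tensor_basis k X m"
proof
  show "fill u ` tensor_basis k X m \<subseteq> labelled (sum_basis k X) u"
    using fill_set[OF assms] by (auto simp: labelled_def)
  show "labelled (sum_basis k X) u \<subseteq> fill u ` tensor_basis k X m"
  proof
    fix W assume "W \<in> labelled (sum_basis k X) u"
    then have W: "set W \<subseteq> sum_basis k X" "map fst W = u" by (auto simp: labelled_def)
    then obtain m' ls where m': "length m' = k" "u \<in> lyndon_B m'" "ls \<in> tensor_basis k X m'" "fill u ls = W"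
      using fill_surj[of W k X] lyndon_BD(1)[OF assms] by blast
    then have "m' = m" using lyndon_B_unique[OF m'(2) assms(1) m'(1) assms(2)] by simp
    then show "W \<in> fill u ` tensor_basis k X m" using m' by blast
  qed
qed

lemma graft_beta_tree:
  assumes "u \<noteq> []" shows "graft (beta_tree u) t = graft word_tree (map_mtree (fill u) t)"
  unfolding graft_map_mtree by (rule graft_cong) (rule beta_tree_eq[OF assms])

lemma beta_sum_FA:
  assumes "D \<in> FA (dom_gens k X)" shows "beta_sum D \<in> FA (trees (sum_basis k X))"
  unfolding beta_sum_def
proof (rule lin_ext_FA[OF assms], clarify)
  fix m u and t :: "'a list list mtree" assume "(m, u, t) \<in> dom_gens k X"
  then have u: "u \<in> lyndon_B m" "length m = k" and t: "t \<in> trees (tensor_basis k X m)" by (auto simp: dom_gens_def)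
  have "map_mtree (fill u) t \<in> trees (labelled (sum_basis k X) u)"
    using t by (auto simp: labelled_eq_image_fill[OF u] trees_def mtree.set_map)
  then show "graft (beta_tree u) t \<in> trees (sum_basis k X)"
    using lyndon_BD[OF u] by (simp add: graft_beta_tree graft_word_tree_trees)
qed

lemma beta_sum_add: "beta_sum (x + y) = beta_sum x + beta_sum y"
  and beta_sum_diff: "beta_sum (x - y) = beta_sum x - beta_sum y"
  by (simp_all add: beta_sum_def lin_ext_add lin_ext_diff)

lemma beta_sum_surj:
  assumes "x \<in> FA (trees (sum_basis k X))"
  shows "\<exists>D\<in>FA (dom_gens k X). x - beta_sum D \<in> lie_ideal (sum_basis k X)"
proof -
  let ?S = "sum_basis k X" and ?G = "{graft word_tree T |w T. lyndon w \<and> T \<in> trees (labelled (sum_basis k X) w)}"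
  have S: "fst p < k" if "p \<in> ?S" for p using that by (auto simp: sum_basis_def)
  have "x \<in> modspan ?S ?G"
    using assms by (induction x rule: FA_induct) (auto intro: modspan_0 modspan_diff tree_in_span S)
  then obtain y where y: "y \<in> FA ?G" "x - y \<in> lie_ideal ?S" by (auto simp: modspan_def)
  from y(1) have "\<exists>D\<in>FA (dom_gens k X). y = beta_sum D"
  proof (induction y rule: FA_induct)
    case zero
    show ?case by (intro bexI[of _ 0]) (auto simp: beta_sum_def)
  next
    case (one s)
    then obtain w T where w: "lyndon w" "T \<in> trees (labelled ?S w)" "s = graft word_tree T" by blast
    define m where "m = map (count_list w) [0..<k]"
    have m: "length m = k" "w \<in> lyndon_B m"
      using w(1) labelled_letters[OF w(2) S] by (auto simp: m_def lyndon_B_def)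
    from trees_image[OF w(2)[unfolded labelled_eq_image_fill[OF m(2,1)]]]
    obtain t where "t \<in> trees (tensor_basis k X m)" "T = map_mtree (fill w) t" by blast
    then have "(m, w, t) \<in> dom_gens k X" "s = graft (beta_tree w) t"
      using m w by (auto simp: dom_gens_def graft_beta_tree lyndon_nonempty)
    then show ?case by (intro bexI[of _ "frag_of (m, w, t)"]) (auto simp: beta_sum_def)
  next
    case (diff a b)
    then obtain D E where "D \<in> FA (dom_gens k X)" "a = beta_sum D" "E \<in> FA (dom_gens k X)" "b = beta_sum E" by blast
    then show ?case by (intro bexI[of _ "D - E"]) (auto simp: beta_sum_diff FA_diff)
  qed
  then show ?thesis using y(2) by blast
qed

subsection \<open>Triangularity\<close>

lemma conv_unit_left: "conv (\<lambda>w. if w = [] then 1 else 0) G w = G w"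
  by (cases w) simp_all

lemma conv_unit_right: "conv F (\<lambda>w. if w = [] then 1 else 0) w = F w"
  by (induction w arbitrary: F) simp_all

lemma conv_homogeneous:
  assumes "\<And>w. F w \<noteq> 0 \<Longrightarrow> length w = n" "n \<le> length w"
  shows "conv F G w = F (take n w) * G (drop n w)"
proof -
  have "conv F G w = (\<Sum>i\<in>{n}. F (take i w) * G (drop i w))"
    unfolding conv_sum_split
  proof (rule sum.mono_neutral_right)
    show "\<forall>i\<in>{..length w} - {n}. F (take i w) * G (drop i w) = 0"
    proof
      fix i assume i: "i \<in> {..length w} - {n}"
      then have "F (take i w) = 0" using assms(1)[of "take i w"] by auto
      then show "F (take i w) * G (drop i w) = 0" by simp
    qed
  qed (use assms in auto)
  then show ?thesis by simp
qed

text \<open>The algebra map of tensor algebras induced by \<open>g\<close>, evaluated at the word in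
  its second argument.\<close>

primrec tau_subst :: "('g \<Rightarrow> 'h mtree) \<Rightarrow> 'g list \<Rightarrow> 'h list \<Rightarrow> 'r::comm_ring_1" where
  "tau_subst g [] = (\<lambda>W. if W = [] then 1 else 0)"
| "tau_subst g (v # V) = conv (tau (g v)) (tau_subst g V)"

lemma tau_subst_append: "tau_subst g (U @ V) = conv (tau_subst g U) (tau_subst g V)"
  by (induction U) (auto simp: conv_unit_left conv_assoc)

text \<open>Substitution of Lie monomials becomes the induced map of tensor algebras. With words of
  one fixed length as index set, pairs of words correspond to their concatenations, and homogeneity
  determines the cut.\<close>

lemma tau_graft_length:
  fixes W :: "'h list"
  assumes "finite A" "set_mtree t \<subseteq> A"
  shows "tau (graft g t) W =
    (\<Sum>V\<in>{V. set V \<subseteq> A \<and> length V = leaves t}. tau t V * tau_subst g V W :: 'r::comm_ring_1)"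
  using assms(2)
proof (induction t arbitrary: W)
  case (Leaf a)
  have "(\<Sum>V\<in>{V. set V \<subseteq> A \<and> length V = leaves (Leaf a)}. tau (Leaf a) V * tau_subst g V W) =
      (\<Sum>V\<in>{[a]}. tau (Leaf a) V * tau_subst g V W :: 'r)"
    using Leaf finite_lists_length_eq[OF assms(1)] by (intro sum.mono_neutral_right) auto
  then show ?case by (simp add: conv_unit_right)
next
  case (Br s t)
  let ?L = "\<lambda>n. {V. set V \<subseteq> A \<and> length V = n}"
  have prod: "conv (tau (graft g s)) (tau (graft g t)) W =
      (\<Sum>V\<in>?L (leaves s + leaves t). conv (tau s) (tau t) V * tau_subst g V W :: 'r)"
    if s: "\<And>W. tau (graft g s) W = (\<Sum>V\<in>?L (leaves s). tau s V * tau_subst g V W :: 'r)"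
      and t: "\<And>W. tau (graft g t) W = (\<Sum>V\<in>?L (leaves t). tau t V * tau_subst g V W :: 'r)" for s t
  proof -
    have s': "tau (graft g s) = (\<lambda>W. \<Sum>V\<in>?L (leaves s). tau s V * tau_subst g V W :: 'r)"
      and t': "tau (graft g t) = (\<lambda>W. \<Sum>V\<in>?L (leaves t). tau t V * tau_subst g V W :: 'r)"
      using s t by (intro ext; blast)+
    have "conv (tau (graft g s)) (tau (graft g t)) W =
        (\<Sum>U\<in>?L (leaves s). \<Sum>V\<in>?L (leaves t). tau s U * tau t V * tau_subst g (U @ V) W :: 'r)"
      by (simp add: s' t' conv_sum_left conv_sum_right conv_cmul_left conv_cmul_right tau_subst_append
          sum_distrib_left mult.assoc)
    also have "\<dots> = (\<Sum>p\<in>?L (leaves s) \<times> ?L (leaves t). tau s (fst p) * tau t (snd p) * tau_subst g (fst p @ snd p) W)"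
      by (simp add: sum.cartesian_product case_prod_beta)
    also have "\<dots> = (\<Sum>V\<in>?L (leaves s + leaves t). tau s (take (leaves s) V) * tau t (drop (leaves s) V) * tau_subst g V W)"
      by (rule sum.reindex_bij_witness[of _ "\<lambda>V. (take (leaves s) V, drop (leaves s) V)" "\<lambda>p. fst p @ snd p"])
         (auto dest: in_set_takeD in_set_dropD)
    also have "\<dots> = (\<Sum>V\<in>?L (leaves s + leaves t). conv (tau s) (tau t) V * tau_subst g V W)"
    proof (intro sum.cong refl)
      fix V assume "V \<in> ?L (leaves s + leaves t)"
      then have "conv (tau s) (tau t) V = (tau s (take (leaves s) V) * tau t (drop (leaves s) V) :: 'r)"
        using tau_support[of s] by (intro conv_homogeneous) auto
      then show "tau s (take (leaves s) V) * tau t (drop (leaves s) V) * tau_subst g V W =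
          (conv (tau s) (tau t) V * tau_subst g V W :: 'r)" by simp
    qed
    finally show ?thesis .
  qed
  show ?case
    using prod[of s t] prod[of t s] Br by (simp add: add.commute left_diff_distrib sum_subtractf)
qed

text \<open>Any finite set containing the support may be the index set, so that all trees of an
  element can share one.\<close>

lemma tau_graft:
  assumes "finite F" "\<And>V. tau t V \<noteq> (0::'r::comm_ring_1) \<Longrightarrow> V \<in> F"
  shows "tau (graft g t) W = (\<Sum>V\<in>F. tau t V * tau_subst g V W :: 'r)"
proof -
  let ?L = "{V. set V \<subseteq> set_mtree t \<and> length V = leaves t}"
  have "tau (graft g t) W = (\<Sum>V\<in>?L. tau t V * tau_subst g V W :: 'r)"
    by (rule tau_graft_length) auto
  also have "\<dots> = (\<Sum>V\<in>F. tau t V * tau_subst g V W)"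
  proof (rule sum.mono_neutral_cong)
    fix V assume "V \<in> ?L - F"
    then have "tau t V = (0::'r)" using assms(2)[of V] by blast
    then show "tau t V * tau_subst g V W = (0::'r)" by simp
  next
    fix V assume "V \<in> F - ?L"
    then have "tau t V = (0::'r)" using tau_support[of t V, where 'r='r] by blast
    then show "tau t V * tau_subst g V W = (0::'r)" by simp
  qed (use assms(1) finite_lists_length_eq[OF finite_set_mtree] in auto)
  finally show ?thesis .
qed

lemma eq_append_iff: "W = A @ B \<longleftrightarrow> take (length A) W = A \<and> drop (length A) W = B"
  by (metis append_eq_conv_conj)

text \<open>In [A,B] the product A B gives the leading term; B A gives only words that are at least
  a proper rotation of the Lyndon word, hence strictly larger. Words are compared by letters, not
  labels, so the leading part is a whole block, on which the map is the identity.\<close>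

lemma tau_word_tree:
  assumes "lyndon (map fst W)"
  shows "tau (word_tree W) W' \<noteq> (0::'r::comm_ring_1) \<Longrightarrow> length W' = length W \<and> map fst W \<le> map fst W'"
    and "map fst W' = map fst W \<Longrightarrow> tau (word_tree W) W' = (if W' = W then 1 else 0 :: 'r)"
proof -
  have "(tau (word_tree W) W' \<noteq> (0::'r) \<longrightarrow> length W' = length W \<and> map fst W \<le> map fst W') \<and>
    (map fst W' = map fst W \<longrightarrow> tau (word_tree W) W' = (if W' = W then 1 else 0 :: 'r))"
    using assms
  proof (induction "length W" arbitrary: W W' rule: less_induct)
    case less
    show ?case
    proof (cases "length W > 1")
      case False
      then obtain x where "W = [x]" using lyndon_nonempty[OF less.prems] by (cases W) auto
      then show ?thesis by (auto simp: map_eq_Cons_conv)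
    next
      case True
      obtain A B where AB: "W = A @ B" "A \<noteq> []" "B \<noteq> []" "lyndon (map fst A)" "lyndon (map fst B)"
        "map fst A < map fst B" "word_tree W = Br (word_tree A) (word_tree B)"
        using word_tree_split[OF less.prems True] by metis
      have A: "tau (word_tree A) V \<noteq> (0::'r) \<Longrightarrow> length V = length A \<and> map fst A \<le> map fst V"
        "map fst V = map fst A \<Longrightarrow> tau (word_tree A) V = (if V = A then 1 else 0 :: 'r)" for V
        using less.hyps[of A V] AB by auto
      have B: "tau (word_tree B) V \<noteq> (0::'r) \<Longrightarrow> length V = length B \<and> map fst B \<le> map fst V"
        "map fst V = map fst B \<Longrightarrow> tau (word_tree B) V = (if V = B then 1 else 0 :: 'r)" for V
        using less.hyps[of B V] AB by auto
      let ?c1 = "conv (tau (word_tree A)) (tau (word_tree B)) W' :: 'r"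
      let ?c2 = "conv (tau (word_tree B)) (tau (word_tree A)) W' :: 'r"
      have c1: "length W' = length W \<and> map fst W \<le> map fst W'" if n: "?c1 \<noteq> 0"
      proof -
        obtain a b where ab: "W' = a @ b" "tau (word_tree A) a \<noteq> (0::'r)" "tau (word_tree B) b \<noteq> (0::'r)"
          using n by (rule conv_nonzero)
        then show ?thesis
          using A(1)[OF ab(2)] B(1)[OF ab(3)] AB(1) by (auto simp: append_le_append_iff)
      qed
      have c2: "length W' = length W \<and> map fst W < map fst W'" if n: "?c2 \<noteq> 0"
      proof -
        obtain a b where ab: "W' = a @ b" "tau (word_tree B) a \<noteq> (0::'r)" "tau (word_tree A) b \<noteq> (0::'r)"
          using n by (rule conv_nonzero)
        have "map fst W < map fst B @ map fst A"
          using less.prems AB(1-3) unfolding lyndon_rotation by auto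
        also have "\<dots> \<le> map fst W'"
          using ab(1) B(1)[OF ab(2)] A(1)[OF ab(3)] by (auto simp: append_le_append_iff)
        finally show ?thesis using ab(1) B(1)[OF ab(2)] A(1)[OF ab(3)] AB(1) by simp
      qed
      have "tau (word_tree W) W' = (if W' = W then 1 else 0 :: 'r)" if e: "map fst W' = map fst W"
      proof -
        have "?c2 = 0" using c2 e by auto
        have len: "length W' = length A + length B" using map_eq_imp_length_eq[OF e] AB(1) by simp
        have "?c1 = tau (word_tree A) (take (length A) W') * tau (word_tree B) (drop (length A) W')"
          using A(1) len by (intro conv_homogeneous) auto
        also have "map fst (take (length A) W') = map fst A" using e AB(1) by (simp add: take_map[symmetric])
        then have "tau (word_tree A) (take (length A) W') = (if take (length A) W' = A then 1 else 0 :: 'r)"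
          by (rule A(2))
        also have "map fst (drop (length A) W') = map fst B" using e AB(1) by (simp add: drop_map[symmetric])
        then have "tau (word_tree B) (drop (length A) W') = (if drop (length A) W' = B then 1 else 0 :: 'r)"
          by (rule B(2))
        also have "(if take (length A) W' = A then 1 else 0) * (if drop (length A) W' = B then 1 else 0) =
            (if W' = W then 1 else 0 :: 'r)"
          unfolding AB(1) eq_append_iff[of W'] by simp
        finally show ?thesis using \<open>?c2 = 0\<close> AB(7) by simp
      qed
      moreover have "?c1 \<noteq> 0 \<or> ?c2 \<noteq> 0" if "tau (word_tree W) W' \<noteq> (0::'r)"
        using that AB(7) by auto
      ultimately show ?thesis using c1 c2 by (auto dest: order.strict_implies_order)
    qed
  qed
  then show "tau (word_tree W) W' \<noteq> (0::'r) \<Longrightarrow> length W' = length W \<and> map fst W \<le> map fst W'"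
    and "map fst W' = map fst W \<Longrightarrow> tau (word_tree W) W' = (if W' = W then 1 else 0 :: 'r)" by auto
qed

text \<open>Leading terms multiply: all factors have the length of u, so the lexicographic
  comparison proceeds block by block.\<close>

lemma tau_subst_beta_tree:
  assumes "lyndon u"
  shows "tau_subst (beta_tree u) V W \<noteq> (0::'r::comm_ring_1) \<Longrightarrow>
      length W = length V * length u \<and> concat (replicate (length V) u) \<le> map fst W"
    and "map fst W = concat (replicate (length V) u) \<Longrightarrow>
      tau_subst (beta_tree u) V W = (if W = concat (map (fill u) V) then 1 else 0 :: 'r)"
proof -
  have bt: "beta_tree u ls = word_tree (fill u ls)" for ls :: "'a list list"
    using assms by (simp add: beta_tree_eq lyndon_nonempty)
  note tw = tau_word_tree[of "fill u _", unfolded map_fst_fill length_fill, OF assms, where 'r='r]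
  have "(tau_subst (beta_tree u) V W \<noteq> (0::'r) \<longrightarrow>
      length W = length V * length u \<and> concat (replicate (length V) u) \<le> map fst W) \<and>
    (map fst W = concat (replicate (length V) u) \<longrightarrow>
      tau_subst (beta_tree u) V W = (if W = concat (map (fill u) V) then 1 else 0 :: 'r))"
  proof (induction V arbitrary: W)
    case (Cons v V)
    show ?case
    proof (intro conjI impI)
      assume "tau_subst (beta_tree u) (v # V) W \<noteq> (0::'r)"
      then have "conv (tau (word_tree (fill u v))) (tau_subst (beta_tree u) V) W \<noteq> (0::'r)" by (simp add: bt)
      then obtain a b where ab: "W = a @ b" "tau (word_tree (fill u v)) a \<noteq> (0::'r)"
        "tau_subst (beta_tree u) V b \<noteq> (0::'r)" by (rule conv_nonzero)
      with tw(1)[OF ab(2)] Cons[of b]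
      show "length W = length (v # V) * length u" "concat (replicate (length (v # V)) u) \<le> map fst W"
        by (auto simp: append_le_append_iff)
    next
      assume e: "map fst W = concat (replicate (length (v # V)) u)"
      then have e': "map fst W = u @ concat (replicate (length V) u)" by simp
      have len: "length u \<le> length W" using arg_cong[OF e', of length] by simp
      have "tau_subst (beta_tree u) (v # V) W =
          (tau (word_tree (fill u v)) (take (length u) W) * tau_subst (beta_tree u) V (drop (length u) W) :: 'r)"
        unfolding tau_subst.simps bt using tw(1) len by (intro conv_homogeneous) blast+
      also have "tau (word_tree (fill u v)) (take (length u) W) = (if take (length u) W = fill u v then 1 else 0 :: 'r)"
        by (rule tw(2)) (use e' in \<open>simp add: take_map[symmetric]\<close>)
      also have "tau_subst (beta_tree u) V (drop (length u) W) =
          (if drop (length u) W = concat (map (fill u) V) then 1 else 0 :: 'r)"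
        by (rule Cons[THEN conjunct2, rule_format]) (use e' in \<open>simp add: drop_map[symmetric]\<close>)
      also have "(if take (length u) W = fill u v then 1 else 0) *
          (if drop (length u) W = concat (map (fill u) V) then 1 else 0) =
          (if W = concat (map (fill u) (v # V)) then 1 else 0 :: 'r)"
        using eq_append_iff[of W "fill u v" "concat (map (fill u) V)"] by simp
      finally show "tau_subst (beta_tree u) (v # V) W = (if W = concat (map (fill u) (v # V)) then 1 else 0 :: 'r)" .
    qed
  qed auto
  then show "tau_subst (beta_tree u) V W \<noteq> (0::'r) \<Longrightarrow>
      length W = length V * length u \<and> concat (replicate (length V) u) \<le> map fst W"
    and "map fst W = concat (replicate (length V) u) \<Longrightarrow>
      tau_subst (beta_tree u) V W = (if W = concat (map (fill u) V) then 1 else 0 :: 'r)" by auto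
qed

lemma map_fst_concat_fill: "map fst (concat (map (fill u) V)) = concat (replicate (length V) u)"
  by (induction V) auto

lemma concat_fill_inj:
  assumes u: "u \<in> lyndon_B m" "length m = k" and "length V = length V'"
    and "set V \<subseteq> tensor_basis k X m" "set V' \<subseteq> tensor_basis k X m"
    and "concat (map (fill u) V) = concat (map (fill u) V')"
  shows "V = V'"
  using assms(3-)
proof (induction V V' rule: list_induct2)
  case (Cons v V v' V')
  then have "fill u v = fill u v'" "concat (map (fill u) V) = concat (map (fill u) V')"
    by (auto simp: append_eq_append_conv)
  then show ?case using Cons fill_inj[OF u, of v X v'] by auto
qed simp

definition component :: "nat list \<Rightarrow> nat list \<Rightarrow> (nat list \<times> nat list \<times> 'g mtree \<Rightarrow>\<^sub>0 int) \<Rightarrow> 'g mtree \<Rightarrow>\<^sub>0 int" where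
  "component m u D = Poly_Mapping.map_key (\<lambda>t. (m, u, t)) D"

lemma lookup_component: "Poly_Mapping.lookup (component m u D) t = Poly_Mapping.lookup D (m, u, t)"
  by (simp add: component_def map_key.rep_eq inj_on_def)

lemma keys_component: "t \<in> Poly_Mapping.keys (component m u D) \<longleftrightarrow> (m, u, t) \<in> Poly_Mapping.keys D"
  by (simp add: in_keys_iff lookup_component)

text \<open>Among the components and words with nonzero coefficient, one with the least leading word
  is chosen. At its labelled leading word nothing else contributes, as any other contribution would
  have a smaller or the same leading word.\<close>

lemma taux_beta_sum_eq_0:
  assumes D: "D \<in> FA (dom_gens k X)" and z: "\<And>W. taux (beta_sum D) W = (0::'r::comm_ring_1)"
  shows "taux (component m u D) V = (0::'r)"
proof -
  let ?K = "(\<lambda>(m, u, t). (m, u)) ` Poly_Mapping.keys D" and ?T = "(\<lambda>(m, u, t). t) ` Poly_Mapping.keys D"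
  define F where "F = (\<Union>t\<in>?T. {V. set V \<subseteq> set_mtree t \<and> length V = leaves t})"
  define c where "c p V = (taux (component (fst p) (snd p) D) V :: 'r)" for p V
  have fin: "finite ?K" "finite ?T" "finite F"
    by (auto simp: F_def intro!: finite_lists_length_eq)
  have F: "V \<in> F" if "t \<in> ?T" "tau t V \<noteq> (0::'r)" for t V
    unfolding F_def using tau_support[OF that(2)] by (intro UN_I[OF that(1)]) simp
  have c: "c p V = (\<Sum>t\<in>?T. of_int (Poly_Mapping.lookup D (fst p, snd p, t)) * tau t V)" for p V
    unfolding c_def taux_def
  proof (subst lin_val_superset[of ?T])
    show "Poly_Mapping.keys (component (fst p) (snd p) D) \<subseteq> ?T"
      by (auto simp: keys_component intro!: image_eqI[of _ _ "(fst p, snd p, _)"])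
  qed (use fin in \<open>simp_all add: lookup_component\<close>)
  have cD: "p \<in> ?K \<and> V \<in> F \<and> V \<noteq> [] \<and> set V \<subseteq> tensor_basis k X (fst p) \<and> length (fst p) = k \<and> snd p \<in> lyndon_B (fst p)"
    if nz: "c p V \<noteq> 0" for p V
  proof -
    have "\<exists>t\<in>?T. of_int (Poly_Mapping.lookup D (fst p, snd p, t)) * tau t V \<noteq> (0::'r)"
    proof (rule ccontr)
      assume "\<not> ?thesis"
      then have "c p V = 0" unfolding c by (intro sum.neutral) blast
      with nz show False by simp
    qed
    then obtain t where t: "t \<in> ?T" "of_int (Poly_Mapping.lookup D (fst p, snd p, t)) * tau t V \<noteq> (0::'r)"
      by blast
    then have n: "tau t V \<noteq> (0::'r)" "Poly_Mapping.lookup D (fst p, snd p, t) \<noteq> 0" by auto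
    then have k: "(fst p, snd p, t) \<in> Poly_Mapping.keys D" by (simp add: in_keys_iff)
    then have "(fst p, snd p, t) \<in> dom_gens k X" using D by (auto simp: FA_def)
    then have "length (fst p) = k" "snd p \<in> lyndon_B (fst p)" "set_mtree t \<subseteq> tensor_basis k X (fst p)"
      by (auto simp: dom_gens_def trees_def)
    moreover have "V \<noteq> []" "set V \<subseteq> set_mtree t"
      using tau_support[OF n(1)] by auto
    moreover have "p \<in> ?K" using k by (intro image_eqI[of _ _ "(fst p, snd p, t)"]) auto
    ultimately show ?thesis using F[OF t(1) n(1)] by auto
  qed
  \<comment> \<open>With one index set F for all trees, the tensor coefficients of each component
    can be collected before the leading terms are compared.\<close>
  have expand: "taux (beta_sum D) W = (\<Sum>q\<in>?K \<times> F. c (fst q) (snd q) * tau_subst (beta_tree (snd (fst q))) (snd q) W)" for W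
  proof -
    have "(taux (beta_sum D) W :: 'r) = (\<Sum>x\<in>Poly_Mapping.keys D. of_int (Poly_Mapping.lookup D x) *
        (case x of (m, u, t) \<Rightarrow> tau (graft (beta_tree u) t) W))"
      unfolding taux_def beta_sum_def lin_val_lin_ext by (simp add: lin_val_def case_prod_beta)
    also have "\<dots> = (\<Sum>x\<in>(\<lambda>(p, t). (fst p, snd p, t)) ` (?K \<times> ?T). of_int (Poly_Mapping.lookup D x) *
        (case x of (m, u, t) \<Rightarrow> tau (graft (beta_tree u) t) W))"
      using fin by (intro sum.mono_neutral_left) (force simp: in_keys_iff)+
    also have "\<dots> = (\<Sum>y\<in>?K \<times> ?T. of_int (Poly_Mapping.lookup D (fst (fst y), snd (fst y), snd y)) *
        tau (graft (beta_tree (snd (fst y))) (snd y)) W)"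
      by (subst sum.reindex) (auto simp: inj_on_def case_prod_beta)
    also have "\<dots> = (\<Sum>p\<in>?K. \<Sum>t\<in>?T. of_int (Poly_Mapping.lookup D (fst p, snd p, t)) *
        tau (graft (beta_tree (snd p)) t) W)"
      by (simp only: sum.cartesian_product' fst_conv snd_conv)
    also have "\<dots> = (\<Sum>p\<in>?K. \<Sum>t\<in>?T. \<Sum>V\<in>F. of_int (Poly_Mapping.lookup D (fst p, snd p, t)) *
        tau t V * tau_subst (beta_tree (snd p)) V W)"
      by (intro sum.cong refl) (simp add: tau_graft[OF fin(3) F] sum_distrib_left mult.assoc)
    also have "\<dots> = (\<Sum>p\<in>?K. \<Sum>V\<in>F. c p V * tau_subst (beta_tree (snd p)) V W)"
      by (subst sum.swap[of _ F]) (simp only: c sum_distrib_right)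
    finally show ?thesis by (simp only: sum.cartesian_product' fst_conv snd_conv)
  qed
  have "c p V = 0" for p V
  proof (rule ccontr)
    assume "c p V \<noteq> 0"
    define Bad where "Bad = {q \<in> ?K \<times> F. c (fst q) (snd q) \<noteq> 0}"
    define key where "key q = concat (replicate (length (snd q)) (snd (fst q)))"
      for q :: "(nat list \<times> nat list) \<times> 'a list list list"
    have "(p, V) \<in> Bad" using \<open>c p V \<noteq> 0\<close> cD by (auto simp: Bad_def)
    then have ne: "key ` Bad \<noteq> {}" by blast
    have "finite Bad" using fin by (simp add: Bad_def)
    then have finB: "finite (key ` Bad)" by simp
    from Min_in[OF finB ne] obtain q where q: "q \<in> Bad" "key q = Min (key ` Bad)" by force
    have min: "key q \<le> key q'" if "q' \<in> Bad" for q' using that q Min_le[OF finB] by simp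
    let ?m = "fst (fst q)" and ?u = "snd (fst q)" and ?V = "snd q"
    have cq: "c (fst q) ?V \<noteq> 0" using q by (simp add: Bad_def)
    note qD = cD[OF cq]
    have u: "lyndon ?u" "?u \<noteq> []" using qD by (auto simp: lyndon_B_def lyndon_nonempty)
    let ?W = "concat (map (fill ?u) ?V)"
    have W: "map fst ?W = key q"
      unfolding key_def by (rule map_fst_concat_fill)
    have other: "c (fst q') (snd q') * tau_subst (beta_tree (snd (fst q'))) (snd q') ?W = (0::'r)"
      if "q' \<in> ?K \<times> F - {q}" for q'
    proof (rule ccontr)
      assume nz: "c (fst q') (snd q') * tau_subst (beta_tree (snd (fst q'))) (snd q') ?W \<noteq> (0::'r)"
      then have c': "c (fst q') (snd q') \<noteq> 0" and t': "tau_subst (beta_tree (snd (fst q'))) (snd q') ?W \<noteq> (0::'r)" by auto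
      note qD' = cD[OF c']
      have u': "lyndon (snd (fst q'))" using qD' by (auto simp: lyndon_B_def)
      have "key q' \<le> key q" using tau_subst_beta_tree(1)[OF u' t'] W by (simp add: key_def)
      moreover have "q' \<in> Bad" using that c' by (simp add: Bad_def)
      ultimately have e: "key q' = key q" using min by (simp add: order_antisym)
      \<comment> \<open>The leading word determines everything: u as its Lyndon root, the exponent
        by length, m by counting letters in u, and the word of tensors by the labels.\<close>
      then have ue: "snd (fst q') = ?u"
        unfolding key_def by (rule lyndon_power_eq[OF u' u(1), rotated 2]) (use qD qD' in auto)
      have "length (key q') = length (key q)" using e by simp
      then have le: "length (snd q') = length ?V"
        using ue u(2) by (simp add: key_def length_concat sum_list_replicate)
      have me: "fst (fst q') = ?m" using lyndon_B_unique[of ?u "fst (fst q')" ?m k] qD qD' ue by simp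
      have "?W = concat (map (fill ?u) (snd q'))"
        using tau_subst_beta_tree(2)[OF u(1), of ?W "snd q'", where 'r='r] t' W ue le
        by (simp add: key_def split: if_splits)
      then have "snd q' = ?V"
        using concat_fill_inj[of ?u ?m k "snd q'" ?V X] qD qD' le me by simp
      then have "q' = q" using me ue by (simp add: prod_eq_iff)
      then show False using that by simp
    qed
    have "0 = (\<Sum>q\<in>?K \<times> F. c (fst q) (snd q) * tau_subst (beta_tree (snd (fst q))) (snd q) ?W)"
      using z[of ?W] expand by simp
    also have "\<dots> = c (fst q) ?V * tau_subst (beta_tree ?u) ?V ?W"
      using fin q other by (subst sum.remove[of _ q]) (auto simp: Bad_def)
    also have "tau_subst (beta_tree ?u) ?V ?W = (1::'r)"
      using tau_subst_beta_tree(2)[OF u(1), of ?W ?V, where 'r='r] W by (simp add: key_def)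
    finally show False using cq by simp
  qed
  from this[of "(m, u)" V] show ?thesis by (simp add: c_def)
qed

subsection \<open>The direct sum\<close>

lemma embed_0 [simp]: "embed m u 0 = 0"
  and embed_minus: "embed m u (- x) = - embed m u x"
  by (simp_all add: embed_def lin_ext_minus)

lemma lookup_embed:
  "Poly_Mapping.lookup (embed m u y) (m', u', t) = (if m' = m \<and> u' = u then Poly_Mapping.lookup y t else 0)"
  unfolding embed_def using subset_UNIV
  by (induction y rule: frag_induction) (auto simp: lin_ext_diff lookup_minus lookup_single when_def)

lemma embed_FA:
  assumes "length m = k" "u \<in> lyndon_B m" "y \<in> FA (trees (tensor_basis k X m))"
  shows "embed m u y \<in> FA (dom_gens k X)"
  unfolding embed_def using assms by (intro lin_ext_FA[OF assms(3)]) (auto simp: dom_gens_def)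

lemma beta_sum_0 [simp]: "beta_sum 0 = 0"
  by (simp add: beta_sum_def)

lemma beta_sum_embed: "beta_sum (embed m u y) = lin_ext (graft (beta_tree u)) y"
  by (simp add: beta_sum_def embed_def lin_ext_lin_ext)

lemma beta_sum_sum: "beta_sum (\<Sum>i\<in>I. f i) = (\<Sum>i\<in>I. beta_sum (f i))"
  by (simp add: beta_sum_def lin_ext_sum)

lemma component_sum_embed:
  assumes "finite K" "(m, u) \<in> K"
  shows "component m u (\<Sum>p\<in>K. embed (fst p) (snd p) (y p)) = y (m, u)"
proof (rule poly_mapping_eqI)
  fix t
  have "Poly_Mapping.lookup (component m u (\<Sum>p\<in>K. embed (fst p) (snd p) (y p))) t =
      (\<Sum>p\<in>K. if p = (m, u) then Poly_Mapping.lookup (y p) t else 0)"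
    unfolding lookup_component lookup_sum by (intro sum.cong refl) (auto simp: lookup_embed prod_eq_iff)
  then show "Poly_Mapping.lookup (component m u (\<Sum>p\<in>K. embed (fst p) (snd p) (y p))) t =
      Poly_Mapping.lookup (y (m, u)) t" using assms by simp
qed

definition support :: "(nat list \<times> nat list \<times> 'g mtree \<Rightarrow>\<^sub>0 int) \<Rightarrow> (nat list \<times> nat list) set" where
  "support D = (\<lambda>(m, u, t). (m, u)) ` Poly_Mapping.keys D"

lemma finite_support [simp]: "finite (support D)"
  by (simp add: support_def)

lemma sum_embed_component: "(\<Sum>p\<in>support D. embed (fst p) (snd p) (component (fst p) (snd p) D)) = D"
proof (rule poly_mapping_eqI)
  fix x :: "nat list \<times> nat list \<times> 'a mtree"
  obtain m u t where x: "x = (m, u, t)" by (cases x)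
  have "Poly_Mapping.lookup (\<Sum>p\<in>support D. embed (fst p) (snd p) (component (fst p) (snd p) D)) x =
      (\<Sum>p\<in>support D. if p = (m, u) then Poly_Mapping.lookup D x else 0)"
    unfolding lookup_sum x by (intro sum.cong refl) (auto simp: lookup_embed lookup_component prod_eq_iff)
  also have "\<dots> = (if (m, u) \<in> support D then Poly_Mapping.lookup D x else 0)" by simp
  also have "\<dots> = Poly_Mapping.lookup D x"
    by (force simp: support_def x in_keys_iff)
  finally show "Poly_Mapping.lookup (\<Sum>p\<in>support D. embed (fst p) (snd p) (component (fst p) (snd p) D)) x =
      Poly_Mapping.lookup D x" .
qed

definition valid_index :: "nat \<Rightarrow> nat list \<times> nat list \<Rightarrow> bool" where
  "valid_index k p \<longleftrightarrow> length (fst p) = k \<and> snd p \<in> lyndon_B (fst p)"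

lemma valid_index_support:
  assumes "D \<in> FA (dom_gens k X)" "p \<in> support D" shows "valid_index k p"
  using assms by (auto simp: FA_def support_def dom_gens_def valid_index_def)

lemma component_FA:
  "D \<in> FA (dom_gens k X) \<Longrightarrow> component m u D \<in> FA (trees (tensor_basis k X m))"
  by (auto simp: FA_def keys_component dom_gens_def)

lemma sum_embed_FA:
  assumes "\<And>p. p \<in> K \<Longrightarrow> valid_index k p" "\<And>p. p \<in> K \<Longrightarrow> y p \<in> FA (trees (tensor_basis k X (fst p)))"
  shows "(\<Sum>p\<in>K. embed (fst p) (snd p) (y p)) \<in> FA (dom_gens k X)"
  using assms by (intro FA_sum embed_FA) (auto simp: valid_index_def)

lemma beta_tree_trees:
  assumes "length m = k" "u \<in> lyndon_B m" "ls \<in> tensor_basis k X m"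
  shows "beta_tree u ls \<in> trees (sum_basis k X)"
  using fill_set[OF assms(2,1,3)] set_word_tree[of "fill u ls"] lyndon_BD(2)[OF assms(2,1)]
  by (auto simp: beta_tree_eq trees_def fill_def)

lemma beta_ideal:
  assumes "length m = k" "u \<in> lyndon_B m" "y \<in> lie_ideal (tensor_basis k X m)"
  shows "lin_ext (graft (beta_tree u)) y \<in> lie_ideal (sum_basis k X)"
  using beta_tree_trees[OF assms(1,2)] assms(3) by (rule lin_ext_graft_ideal)

lemma beta_FA:
  assumes "length m = k" "u \<in> lyndon_B m" "y \<in> FA (trees (tensor_basis k X m))"
  shows "lin_ext (graft (beta_tree u)) y \<in> FA (trees (sum_basis k X))"
  using assms(3) by (rule lin_ext_FA) (rule graft_trees[OF beta_tree_trees[OF assms(1,2)]])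

lemma beta_sum_dom_ideal:
  assumes "x \<in> dom_ideal k X" shows "beta_sum x \<in> lie_ideal (sum_basis k X)"
  using assms
  by induction (auto simp: beta_sum_embed beta_sum_add beta_ideal intro: lie_ideal.intros)

text \<open>\<open>dom_ideal\<close> is built from sums only; negatives come from the Lie ideals of
  the summands.\<close>

lemma dom_ideal_minus: "x \<in> dom_ideal k X \<Longrightarrow> - x \<in> dom_ideal k X"
proof (induction rule: dom_ideal.induct)
  case (emb m u y)
  then show ?case using dom_ideal.emb[of m k u "- y" X] by (simp add: embed_minus lie_ideal.neg)
next
  case (add x y)
  then show ?case using dom_ideal.add[of "- x" k X "- y"] by simp
qed (auto intro: dom_ideal.zero)

lemma dom_ideal_diff: "x \<in> dom_ideal k X \<Longrightarrow> y \<in> dom_ideal k X \<Longrightarrow> x - y \<in> dom_ideal k X"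
  using dom_ideal.add[of x k X "- y"] dom_ideal_minus by fastforce

lemma dom_ideal_sum: "(\<And>i. i \<in> I \<Longrightarrow> f i \<in> dom_ideal k X) \<Longrightarrow> (\<Sum>i\<in>I. f i) \<in> dom_ideal k X"
  by (induction I rule: infinite_finite_induct) (auto intro: dom_ideal.zero dom_ideal.add)

text \<open>Each component map sends squares to squares, and since squaring is additive modulo the
  ideal, the squares of all components merge into one.\<close>

lemma beta_sum_squares:
  assumes K: "finite K" "\<And>p. p \<in> K \<Longrightarrow> valid_index k p"
    and y: "\<And>p. p \<in> K \<Longrightarrow> y p \<in> FA (trees (tensor_basis k X (fst p)))"
    and x: "\<And>p. p \<in> K \<Longrightarrow> x p - bracket (y p) (y p) \<in> lie_ideal (tensor_basis k X (fst p))"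
    and D: "D = (\<Sum>p\<in>K. embed (fst p) (snd p) (x p))" "E = (\<Sum>p\<in>K. embed (fst p) (snd p) (y p))"
  shows "beta_sum D - bracket (beta_sum E) (beta_sum E) \<in> lie_ideal (sum_basis k X)"
proof -
  let ?b = "\<lambda>p. lin_ext (graft (beta_tree (snd p)))"
  have bE: "beta_sum E = (\<Sum>p\<in>K. ?b p (y p))" and bD: "beta_sum D = (\<Sum>p\<in>K. ?b p (x p))"
    by (simp_all add: D beta_sum_sum beta_sum_embed)
  have "(\<Sum>p\<in>K. ?b p (x p - bracket (y p) (y p))) \<in> lie_ideal (sum_basis k X)"
  proof (rule lie_ideal_sum)
    fix p assume "p \<in> K"
    then show "?b p (x p - bracket (y p) (y p)) \<in> lie_ideal (sum_basis k X)"
      using K x by (intro beta_ideal[of "fst p"]) (auto simp: valid_index_def)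
  qed
  then have 1: "beta_sum D - (\<Sum>p\<in>K. bracket (?b p (y p)) (?b p (y p))) \<in> lie_ideal (sum_basis k X)"
    by (simp add: bD lin_ext_diff lin_ext_graft_bracket sum_subtractf)
  have 2: "bracket (beta_sum E) (beta_sum E) - (\<Sum>p\<in>K. bracket (?b p (y p)) (?b p (y p))) \<in> lie_ideal (sum_basis k X)"
    unfolding bE
  proof (rule square_sum)
    fix p assume "p \<in> K"
    then show "?b p (y p) \<in> FA (trees (sum_basis k X))"
      using K y by (intro beta_FA[of "fst p"]) (auto simp: valid_index_def)
  qed (rule K)
  from lie_ideal_diff[OF 1 2] show ?thesis by simp
qed

subsection \<open>The kernel of the map to the tensor algebra\<close>

text \<open>Brackets with [a,a] vanish because squares are central, so a and [a,a] span a set closed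
  under brackets.\<close>

lemma one_generator_normal_form:
  assumes "z \<in> FA (trees {a})"
  obtains n e where "z - (frag_cmul n (frag_of (Leaf a)) + frag_cmul e (frag_of (Br (Leaf a) (Leaf a)))) \<in> lie_ideal {a}"
proof -
  let ?a = "Leaf a" and ?G = "{Leaf a, Br (Leaf a) (Leaf a)}"
  have a: "frag_of ?a \<in> FA (trees {a})" by simp
  have central: "frag_of (Br t (Br ?a ?a)) \<in> lie_ideal {a}" "frag_of (Br (Br ?a ?a) t) \<in> lie_ideal {a}"
    if "t \<in> trees {a}" for t
    using square_central[OF a, of "frag_of t"] that by simp_all
  have gen: "frag_of t \<in> modspan {a} ?G" if "t \<in> trees {a}" for t
    using that
  proof (induction t)
    case (Br s t)
    have "bracket (frag_of s) (frag_of t) \<in> modspan {a} ?G"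
    proof (rule modspan_bracket)
      fix s t assume st: "s \<in> ?G" "t \<in> ?G"
      show "frag_of (Br s t) \<in> modspan {a} ?G"
      proof (cases "s = ?a \<and> t = ?a")
        case False
        then have "frag_of (Br s t) - 0 \<in> lie_ideal {a}"
          using st central[of ?a] central[of "Br ?a ?a"] by auto
        then show ?thesis by (rule modspan_cong[OF _ modspan_0])
      qed (auto intro: modspan_of)
    qed (use Br in auto)
    then show ?case by simp
  qed (auto intro: modspan_of)
  have "z \<in> modspan {a} ?G"
    using assms by (induction z rule: FA_induct) (auto intro: modspan_0 modspan_diff gen)
  then obtain y where y: "y \<in> FA ?G" "z - y \<in> lie_ideal {a}" by (auto simp: modspan_def)
  have "y = frag_cmul (Poly_Mapping.lookup y ?a) (frag_of ?a) +
      frag_cmul (Poly_Mapping.lookup y (Br ?a ?a)) (frag_of (Br ?a ?a))"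
    by (rule poly_mapping_eqI) (use y(1) in \<open>auto simp: FA_def lookup_add in_keys_iff\<close>)
  then show thesis using y(2) that by metis
qed

lemma even_square_in_ideal:
  assumes "a \<in> FA (trees S)" "even e"
  shows "frag_cmul e (bracket a a) \<in> lie_ideal S"
proof -
  obtain j where "e = 2 * j" using assms(2) by blast
  then have "frag_cmul e (bracket a a) = frag_cmul j (bracket a a + bracket a a)"
    by (simp add: frag_cmul_distrib2 frag_cmul_distrib[symmetric])
  then show ?thesis using double_square[OF assms(1)] lie_ideal_cmul by simp
qed

lemma of_int_bit_eq_0: "of_int n = (0::bit) \<Longrightarrow> even n"
proof (rule ccontr)
  assume "of_int n = (0::bit)" "odd n"
  then obtain j where "n = 2 * j + 1" by (auto elim: oddE)
  then have "(of_int n :: bit) = 2 * of_int j + 1" by (simp only: of_int_add of_int_mult of_int_numeral of_int_1)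
  then show False using \<open>of_int n = (0::bit)\<close> by simp
qed

lemma rank_one_tensor_basis:
  assumes "length m = k"
  shows "tensor_basis k (\<lambda>i. {e i}) m = {map (\<lambda>i. replicate (m ! i) (e i)) [0..<k]}" (is "_ = {?l}")
proof
  show "tensor_basis k (\<lambda>i. {e i}) m \<subseteq> {?l}"
  proof
    fix ls assume ls: "ls \<in> tensor_basis k (\<lambda>i. {e i}) m"
    have "ls = ?l"
    proof (rule nth_equalityI)
      show "length ls = length ?l" using ls by (simp add: tensor_basis_def)
      fix i assume "i < length ls"
      then have i: "i < k" "length (ls ! i) = m ! i" "set (ls ! i) \<subseteq> {e i}" using ls by (auto simp: tensor_basis_def)
      then have "ls ! i = replicate (m ! i) (e i)" by (intro replicate_eqI) auto
      then show "ls ! i = ?l ! i" using i by simp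
    qed
    then show "ls \<in> {?l}" by simp
  qed
qed (auto simp: tensor_basis_def)

text \<open>Each tensor product has one basis element, so each component is n a + c [a,a]. The
  tensor algebra sees n as the coefficient of a one-letter word and does not see c. Over
  \<open>int\<close> this gives n = 0, over \<open>bit\<close> that n is even.\<close>

lemma rank_one_expansion:
  fixes x :: "(nat \<times> 'a) mtree \<Rightarrow>\<^sub>0 int"
  assumes x: "x \<in> FA (trees (sum_basis k (\<lambda>i. {e i})))" and z: "taux x = (\<lambda>w. 0::'r::comm_ring_1)"
  obtains D a n c where "D \<in> FA (dom_gens k (\<lambda>i. {e i}))"
    "x - beta_sum D \<in> lie_ideal (sum_basis k (\<lambda>i. {e i}))"
    "\<forall>p\<in>support D. frag_of (Leaf (a p)) \<in> FA (trees (tensor_basis k (\<lambda>i. {e i}) (fst p))) \<and>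
      component (fst p) (snd p) D - (frag_cmul (n p) (frag_of (Leaf (a p))) + frag_cmul (c p) (frag_of (Br (Leaf (a p)) (Leaf (a p)))))
        \<in> lie_ideal (tensor_basis k (\<lambda>i. {e i}) (fst p)) \<and> of_int (n p) = (0::'r)"
proof -
  let ?X = "\<lambda>i. {e i}"
  obtain D where D: "D \<in> FA (dom_gens k ?X)" "x - beta_sum D \<in> lie_ideal (sum_basis k ?X)"
    using beta_sum_surj[OF x] by blast
  have "taux (beta_sum D) W = (0::'r)" for W
    using fun_cong[OF taux_ideal[OF D(2), where 'r='r], of W] fun_cong[OF z, of W] by (simp add: taux_diff)
  note c0 = taux_beta_sum_eq_0[OF D(1) this]
  define a where "a p = map (\<lambda>i. replicate (fst p ! i) (e i)) [0..<k]" for p :: "nat list \<times> nat list"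
  have "\<exists>n c. component (fst p) (snd p) D - (frag_cmul n (frag_of (Leaf (a p))) + frag_cmul c (frag_of (Br (Leaf (a p)) (Leaf (a p)))))
        \<in> lie_ideal (tensor_basis k ?X (fst p)) \<and> of_int n = (0::'r)" if p: "p \<in> support D" for p
  proof -
    have tb: "tensor_basis k ?X (fst p) = {a p}"
      using valid_index_support[OF D(1) p] by (simp add: valid_index_def rank_one_tensor_basis a_def)
    have "component (fst p) (snd p) D \<in> FA (trees {a p})"
      using component_FA[OF D(1), of "fst p" "snd p"] tb by simp
    then obtain n c where nc: "component (fst p) (snd p) D - (frag_cmul n (frag_of (Leaf (a p))) + frag_cmul c (frag_of (Br (Leaf (a p)) (Leaf (a p)))))
        \<in> lie_ideal {a p}" by (rule one_generator_normal_form)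
    from fun_cong[OF taux_ideal[OF this, where 'r='r], of "[a p]"] c0
    have "of_int n = (0::'r)" by (simp add: taux_diff taux_add taux_cmul)
    then show ?thesis using nc tb by auto
  qed
  then obtain n c where "\<forall>p\<in>support D. component (fst p) (snd p) D - (frag_cmul (n p) (frag_of (Leaf (a p))) + frag_cmul (c p) (frag_of (Br (Leaf (a p)) (Leaf (a p)))))
        \<in> lie_ideal (tensor_basis k ?X (fst p)) \<and> of_int (n p) = (0::'r)" by metis
  moreover have "frag_of (Leaf (a p)) \<in> FA (trees (tensor_basis k ?X (fst p)))" if "p \<in> support D" for p
    using valid_index_support[OF D(1) that] by (simp add: valid_index_def rank_one_tensor_basis a_def)
  ultimately show thesis using D by (intro that[of D a n c]) auto
qed

lemma rank_one_kernel:
  assumes x: "x \<in> FA (trees (sum_basis k (\<lambda>i. {e i})))" and z: "taux x = (\<lambda>w. 0::int)"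
  shows "\<exists>y\<in>FA (trees (sum_basis k (\<lambda>i. {e i}))). x - bracket y y \<in> lie_ideal (sum_basis k (\<lambda>i. {e i}))"
proof -
  let ?X = "\<lambda>i. {e i}"
  obtain D a n c where D: "D \<in> FA (dom_gens k ?X)" "x - beta_sum D \<in> lie_ideal (sum_basis k ?X)"
    and p: "\<forall>p\<in>support D. frag_of (Leaf (a p)) \<in> FA (trees (tensor_basis k ?X (fst p))) \<and>
      component (fst p) (snd p) D - (frag_cmul (n p) (frag_of (Leaf (a p))) + frag_cmul (c p) (frag_of (Br (Leaf (a p)) (Leaf (a p)))))
        \<in> lie_ideal (tensor_basis k ?X (fst p)) \<and> of_int (n p) = (0::int)"
    by (rule rank_one_expansion[OF x z])
  \<comment> \<open>[c a, c a] = c^2 [a,a] agrees with c [a,a] because c - c^2 is even and 2 [a,a] =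
    0.\<close>
  define y where "y p = frag_cmul (c p) (frag_of (Leaf (a p)))" for p
  define E where "E = (\<Sum>p\<in>support D. embed (fst p) (snd p) (y p))"
  have y: "y p \<in> FA (trees (tensor_basis k ?X (fst p)))" if "p \<in> support D" for p
    unfolding y_def using p that by (intro FA_cmul) auto
  have sq: "component (fst p) (snd p) D - bracket (y p) (y p) \<in> lie_ideal (tensor_basis k ?X (fst p))"
    if "p \<in> support D" for p
  proof -
    let ?a = "frag_of (Leaf (a p))" and ?I = "lie_ideal (tensor_basis k ?X (fst p))"
    have "component (fst p) (snd p) D - frag_cmul (c p) (bracket ?a ?a) \<in> ?I" using p that by auto
    moreover have "frag_cmul (c p - c p * c p) (bracket ?a ?a) \<in> ?I"
      using p that by (intro even_square_in_ideal) auto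
    ultimately have "component (fst p) (snd p) D - frag_cmul (c p) (bracket ?a ?a) +
        frag_cmul (c p - c p * c p) (bracket ?a ?a) \<in> ?I" by (rule lie_ideal.add)
    also have "component (fst p) (snd p) D - frag_cmul (c p) (bracket ?a ?a) +
        frag_cmul (c p - c p * c p) (bracket ?a ?a) = component (fst p) (snd p) D - bracket (y p) (y p)"
      by (rule poly_mapping_eqI)
         (simp add: y_def bracket_cmul_left bracket_cmul_right lookup_add lookup_minus algebra_simps)
    finally show ?thesis .
  qed
  have "beta_sum D - bracket (beta_sum E) (beta_sum E) \<in> lie_ideal (sum_basis k ?X)"
    by (rule beta_sum_squares[of "support D" k y ?X "\<lambda>p. component (fst p) (snd p) D"])
       (auto simp: y sq E_def sum_embed_component valid_index_support[OF D(1)])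
  from lie_ideal.add[OF D(2) this] have "x - bracket (beta_sum E) (beta_sum E) \<in> lie_ideal (sum_basis k ?X)" by simp
  moreover have "beta_sum E \<in> FA (trees (sum_basis k ?X))"
    unfolding E_def by (intro beta_sum_FA sum_embed_FA y valid_index_support[OF D(1)])
  ultimately show ?thesis by blast
qed

lemma rank_one_square:
  assumes x: "x \<in> FA (trees (sum_basis k (\<lambda>i. {e i})))" and z: "taux x = (\<lambda>w. 0::bit)"
  shows "bracket x x \<in> lie_ideal (sum_basis k (\<lambda>i. {e i}))"
proof -
  let ?X = "\<lambda>i. {e i}" and ?S = "sum_basis k (\<lambda>i. {e i})"
  obtain D a n c where D: "D \<in> FA (dom_gens k ?X)" "x - beta_sum D \<in> lie_ideal ?S"
    and p: "\<forall>p\<in>support D. frag_of (Leaf (a p)) \<in> FA (trees (tensor_basis k ?X (fst p))) \<and>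
      component (fst p) (snd p) D - (frag_cmul (n p) (frag_of (Leaf (a p))) + frag_cmul (c p) (frag_of (Br (Leaf (a p)) (Leaf (a p)))))
        \<in> lie_ideal (tensor_basis k ?X (fst p)) \<and> of_int (n p) = (0::bit)"
    by (rule rank_one_expansion[OF x z])
  have sq: "0 - bracket (component (fst p) (snd p) D) (component (fst p) (snd p) D) \<in> lie_ideal (tensor_basis k ?X (fst p))"
    if "p \<in> support D" for p
  proof -
    let ?a = "frag_of (Leaf (a p))" and ?T = "tensor_basis k ?X (fst p)" and ?y = "component (fst p) (snd p) D"
    let ?z = "frag_cmul (n p) ?a + frag_cmul (c p) (bracket ?a ?a)"
    have a: "?a \<in> FA (trees ?T)" and yz: "?y - ?z \<in> lie_ideal ?T" and "even (n p)"
      using p that of_int_bit_eq_0 by auto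
    have aa: "bracket ?a ?a \<in> FA (trees ?T)" using a a by (rule bracket_FA)
    have z: "?z \<in> FA (trees ?T)" using a aa by (intro FA_add FA_cmul)
    \<comment> \<open>The expansion of [z,z]: the first term is zero modulo the ideal since n is
      even, the others since [a,a] is central.\<close>
    have "frag_cmul (n p * n p) (bracket ?a ?a) + frag_cmul (n p * c p) (bracket ?a (bracket ?a ?a))
        + (frag_cmul (c p * n p) (bracket (bracket ?a ?a) ?a)
        + frag_cmul (c p * c p) (bracket (bracket ?a ?a) (bracket ?a ?a))) \<in> lie_ideal ?T"
      using a aa \<open>even (n p)\<close>
      by (intro lie_ideal.add even_square_in_ideal lie_ideal_cmul square_central) auto
    then have "bracket ?z ?z \<in> lie_ideal ?T"
      by (simp only: bracket_add_left bracket_add_right bracket_cmul_left bracket_cmul_right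
          frag_cmul_cmul frag_cmul_distrib2 add_ac mult.commute)
    moreover have "?y \<in> FA (trees ?T)" by (rule component_FA[OF D(1)])
    then have "bracket ?y ?y - bracket ?z ?z \<in> lie_ideal ?T"
      using yz z by (intro bracket_cong_ideal)
    ultimately have "bracket ?y ?y \<in> lie_ideal ?T" using lie_ideal_cong by blast
    then show ?thesis by (simp add: lie_ideal.neg)
  qed
  have "beta_sum 0 - bracket (beta_sum D) (beta_sum D) \<in> lie_ideal ?S"
    by (rule beta_sum_squares[of "support D" k "\<lambda>p. component (fst p) (snd p) D" ?X "\<lambda>p. 0"])
       (use sq in \<open>auto simp: sum_embed_component valid_index_support[OF D(1)] component_FA[OF D(1)]\<close>)
  then have "bracket (beta_sum D) (beta_sum D) \<in> lie_ideal ?S"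
    by (simp add: lie_ideal_minus_iff)
  moreover have "bracket x x - bracket (beta_sum D) (beta_sum D) \<in> lie_ideal ?S"
    using D x by (intro bracket_cong_ideal beta_sum_FA)
  ultimately show ?thesis using lie_ideal_cong by blast
qed

section \<open>From rank one groups to arbitrary sets of generators\<close>

lemma taux_graft_eq_0:
  assumes "taux x = (\<lambda>w. 0::'r::comm_ring_1)"
  shows "taux (lin_ext (graft f) x) = (\<lambda>w. 0::'r)"
proof
  fix W
  define F where "F = (\<Union>t\<in>Poly_Mapping.keys x. {V. set V \<subseteq> set_mtree t \<and> length V = leaves t})"
  have fin: "finite F" by (auto simp: F_def intro!: finite_lists_length_eq)
  have F: "V \<in> F" if "t \<in> Poly_Mapping.keys x" "tau t V \<noteq> (0::'r)" for t V
    unfolding F_def using tau_support[OF that(2)] by (intro UN_I[OF that(1)]) simp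
  have "taux (lin_ext (graft f) x) W = (lin_val (\<lambda>t. tau (graft f t) W) x :: 'r)"
    by (simp add: taux_def lin_val_lin_ext)
  also have "\<dots> = (\<Sum>t\<in>Poly_Mapping.keys x. \<Sum>V\<in>F. of_int (Poly_Mapping.lookup x t) * tau t V * tau_subst f V W :: 'r)"
    unfolding lin_val_def
    by (intro sum.cong refl) (simp add: tau_graft[OF fin F] sum_distrib_left mult.assoc)
  also have "\<dots> = (\<Sum>V\<in>F. taux x V * tau_subst f V W)"
    by (subst sum.swap) (simp add: taux_def lin_val_def sum_distrib_right)
  finally show "taux (lin_ext (graft f) x) W = (0::'r)" using assms by simp
qed

text \<open>The tag makes each of the finitely many generators in x the basis of a rank one group of
  its own, and g forgets it. Relations found in rank one are thus carried back to any set of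
  generators, in particular to the tensor bases.\<close>

lemma rank_one_relabelling:
  fixes x :: "'g mtree \<Rightarrow>\<^sub>0 int"
  assumes "x \<in> FA (trees A)"
  obtains f k e g where "lin_ext (graft f) x \<in> FA (trees (sum_basis k (\<lambda>i. {e i :: 'g})))"
    "lin_ext (graft g) (lin_ext (graft f) x) = x"
    "\<forall>s\<in>sum_basis k (\<lambda>i. {e i}). g s \<in> trees A"
proof -
  define A' where "A' = (\<Union>t\<in>Poly_Mapping.keys x. set_mtree t)"
  have "finite A'" by (simp add: A'_def)
  then obtain e where e: "bij_betw e {0..<card A'} A'" using ex_bij_betw_nat_finite by blast
  define j where "j = the_inv_into {0..<card A'} e"
  define f where "f a = Leaf (j a, a)" for a
  define g where "g s = Leaf (snd s)" for s :: "nat \<times> 'g"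
  have sub: "A' \<subseteq> A" using assms by (auto simp: A'_def FA_def trees_def)
  have j: "j a < card A'" "e (j a) = a" if "a \<in> A'" for a
    using that e bij_betwE[OF bij_betw_the_inv_into[OF e]] f_the_inv_into_f_bij_betw[OF e]
    by (auto simp: j_def)
  have "x \<in> FA (trees A')" by (auto simp: FA_def trees_def A'_def)
  then have 1: "lin_ext (graft f) x \<in> FA (trees (sum_basis (card A') (\<lambda>i. {e i})))"
    by (rule lin_ext_FA) (auto intro!: graft_trees[of A'] simp: f_def sum_basis_def j)
  have "graft g (graft f t) = t" for t by (induction t) (auto simp: f_def g_def)
  then have 2: "lin_ext (graft g) (lin_ext (graft f) x) = x"
    by (simp add: lin_ext_lin_ext lin_ext_id)
  have "e i \<in> A" if "i < card A'" for i using that e sub by (auto simp: bij_betw_def)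
  then have 3: "\<forall>s\<in>sum_basis (card A') (\<lambda>i. {e i}). g s \<in> trees A"
    by (auto simp: sum_basis_def g_def)
  show thesis by (rule that[OF 1 2 3])
qed

lemma kernel_square:
  fixes x :: "'g mtree \<Rightarrow>\<^sub>0 int"
  assumes x: "x \<in> FA (trees A)" and z: "taux x = (\<lambda>w. 0::int)"
  shows "\<exists>y\<in>FA (trees A). x - bracket y y \<in> lie_ideal A"
proof -
  obtain f k e g where x': "lin_ext (graft f) x \<in> FA (trees (sum_basis k (\<lambda>i. {e i :: 'g})))"
    and gf: "lin_ext (graft g) (lin_ext (graft f) x) = x"
    and g: "\<forall>s\<in>sum_basis k (\<lambda>i. {e i}). g s \<in> trees A"
    by (rule rank_one_relabelling[OF x])
  obtain y where y: "y \<in> FA (trees (sum_basis k (\<lambda>i. {e i})))"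
    "lin_ext (graft f) x - bracket y y \<in> lie_ideal (sum_basis k (\<lambda>i. {e i}))"
    using rank_one_kernel[OF x' taux_graft_eq_0[OF z]] by blast
  have "lin_ext (graft g) y \<in> FA (trees A)" using y(1) by (rule lin_ext_FA) (rule graft_trees[OF g[rule_format]])
  moreover have "x - bracket (lin_ext (graft g) y) (lin_ext (graft g) y) \<in> lie_ideal A"
    using lin_ext_graft_ideal[of _ g A, OF _ y(2)] g by (simp add: lin_ext_diff gf lin_ext_graft_bracket)
  ultimately show ?thesis by blast
qed

lemma square_in_ideal_if_taux_even:
  fixes x :: "'g mtree \<Rightarrow>\<^sub>0 int"
  assumes x: "x \<in> FA (trees A)" and z: "taux x = (\<lambda>w. 0::bit)"
  shows "bracket x x \<in> lie_ideal A"
proof -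
  obtain f k e g where x': "lin_ext (graft f) x \<in> FA (trees (sum_basis k (\<lambda>i. {e i :: 'g})))"
    and gf: "lin_ext (graft g) (lin_ext (graft f) x) = x"
    and g: "\<forall>s\<in>sum_basis k (\<lambda>i. {e i}). g s \<in> trees A"
    by (rule rank_one_relabelling[OF x])
  show ?thesis
    using lin_ext_graft_ideal[of _ g A, OF _ rank_one_square[OF x' taux_graft_eq_0[OF z]]] g
    by (simp add: gf lin_ext_graft_bracket)
qed

subsection \<open>Injectivity and the isomorphism\<close>

lemma beta_sum_inj:
  assumes D: "D \<in> FA (dom_gens k X)" and I: "beta_sum D \<in> lie_ideal (sum_basis k X)"
  shows "D \<in> dom_ideal k X"
proof -
  let ?T = "\<lambda>p. tensor_basis k X (fst p)" and ?D = "\<lambda>p. component (fst p) (snd p) D"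
  note valid = valid_index_support[OF D]
  have "taux (?D p) = (\<lambda>w. 0::int)" for p
    using taux_beta_sum_eq_0[OF D, where 'r=int] taux_ideal[OF I, where 'r=int] by auto
  then have "\<forall>p. \<exists>y\<in>FA (trees (?T p)). ?D p - bracket y y \<in> lie_ideal (?T p)"
    using kernel_square[OF component_FA[OF D]] by blast
  then obtain y where y: "y p \<in> FA (trees (?T p))" "?D p - bracket (y p) (y p) \<in> lie_ideal (?T p)" for p
    by metis
  define E where "E = (\<Sum>p\<in>support D. embed (fst p) (snd p) (y p))"
  have E: "E \<in> FA (dom_gens k X)"
    unfolding E_def by (rule sum_embed_FA) (auto simp: valid y)
  have "beta_sum D - bracket (beta_sum E) (beta_sum E) \<in> lie_ideal (sum_basis k X)"
    by (rule beta_sum_squares[of "support D" k y X ?D]) (auto simp: valid y E_def sum_embed_component)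
  then have "bracket (beta_sum E) (beta_sum E) \<in> lie_ideal (sum_basis k X)"
    using I lie_ideal_cong by blast
  \<comment> \<open>Triangularity modulo 2 now applies to E, the sum of the square roots, and
    separates its components.\<close>
  then have "taux (beta_sum E) W = (0::bit)" for W
    by (rule taux_eq_0_if_square_in_ideal[rotated 2]) (auto intro: bit.exhaust)
  note c0 = taux_beta_sum_eq_0[OF E this]
  have "?D p \<in> lie_ideal (?T p)" if "p \<in> support D" for p
  proof -
    have "taux (y p) = (\<lambda>w. 0::bit)"
      using c0[of "fst p" "snd p"] component_sum_embed[of "support D" "fst p" "snd p" y] that
      by (auto simp: E_def)
    then have "bracket (y p) (y p) \<in> lie_ideal (?T p)"
      using y(1) by (intro square_in_ideal_if_taux_even)
    then show ?thesis using y(2)[of p] lie_ideal_cong by blast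
  qed
  then have "(\<Sum>p\<in>support D. embed (fst p) (snd p) (?D p)) \<in> dom_ideal k X"
    using valid by (intro dom_ideal_sum dom_ideal.emb) (auto simp: valid_index_def)
  then show ?thesis by (simp add: sum_embed_component)
qed

section \<open>Passage to the quotients\<close>

lemma coset_eq_iff:
  assumes I: "0 \<in> I" "\<And>a b. a \<in> I \<Longrightarrow> b \<in> I \<Longrightarrow> a - b \<in> I" and "x \<in> A" "y \<in> A"
  shows "coset A I x = coset A I y \<longleftrightarrow> x - y \<in> I"
proof
  assume "coset A I x = coset A I y"
  moreover have "x \<in> coset A I x" using assms by (simp add: coset_def)
  ultimately show "x - y \<in> I" by (simp add: coset_def)
next
  assume xy: "x - y \<in> I"
  have "z - x \<in> I \<longleftrightarrow> z - y \<in> I" for z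
    using I(2)[OF _ xy, of "z - y"] I(2)[OF _ I(2)[OF I(1) xy], of "z - x"] by auto
  then show "coset A I x = coset A I y" by (auto simp: coset_def)
qed

text \<open>\<open>induced\<close> evaluates F at a chosen representative; the result is independent
  of the choice because F maps I into J.\<close>

lemma induced_bij_betw:
  assumes I: "0 \<in> I" "\<And>a b. a \<in> I \<Longrightarrow> b \<in> I \<Longrightarrow> a - b \<in> I"
    and J: "0 \<in> J" "\<And>a b. a \<in> J \<Longrightarrow> b \<in> J \<Longrightarrow> a - b \<in> J"
    and A: "\<And>a b. a \<in> A \<Longrightarrow> b \<in> A \<Longrightarrow> a - b \<in> A"
    and F: "\<And>a b. F (a - b) = F a - F b" "\<And>a. a \<in> A \<Longrightarrow> F a \<in> B" "\<And>a. a \<in> I \<Longrightarrow> F a \<in> J"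
    and inj: "\<And>a. a \<in> A \<Longrightarrow> F a \<in> J \<Longrightarrow> a \<in> I"
    and surj: "\<And>b. b \<in> B \<Longrightarrow> \<exists>a\<in>A. b - F a \<in> J"
  shows "bij_betw (induced B J F) (quot A I) (quot B J)"
proof -
  note eqA = coset_eq_iff[of I _ A, OF I] and eqB = coset_eq_iff[of J _ B, OF J]
  have ind: "induced B J F (coset A I x) = coset B J (F x)" if "x \<in> A" for x
  proof -
    have "x \<in> coset A I x" using that I by (simp add: coset_def)
    then have "(SOME z. z \<in> coset A I x) \<in> coset A I x" by (rule someI)
    then have "(SOME z. z \<in> coset A I x) \<in> A" "(SOME z. z \<in> coset A I x) - x \<in> I" by (auto simp: coset_def)
    then show ?thesis using F that by (auto simp: induced_def eqB F(1)[symmetric])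
  qed
  show ?thesis
    unfolding bij_betw_def
  proof
    show "inj_on (induced B J F) (quot A I)"
      using A inj by (auto simp: inj_on_def quot_def ind eqA eqB F(2) F(1)[symmetric])
    have "coset B J b \<in> induced B J F ` quot A I" if b: "b \<in> B" for b
    proof -
      obtain a where a: "a \<in> A" "b - F a \<in> J" using surj[OF b] by blast
      then have "coset B J b = induced B J F (coset A I a)" using b by (simp add: ind eqB F)
      then show ?thesis using a by (auto simp: quot_def)
    qed
    then show "induced B J F ` quot A I = quot B J"
      by (auto simp: quot_def ind F)
  qed
qed

theorem theorem3p15:
  fixes k :: nat and X :: "nat \<Rightarrow> 'a set"
  shows "(\<forall>x \<in> dom_ideal k X. beta_sum x \<in> lie_ideal (sum_basis k X)) \<and>
         bij_betw (induced (FA (trees (sum_basis k X))) (lie_ideal (sum_basis k X)) beta_sum)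
                  (dom_sum k X) (Lie (sum_basis k X))"
  unfolding dom_sum_def Lie_def
  by (intro conjI ballI induced_bij_betw beta_sum_dom_ideal beta_sum_surj)
     (auto intro: dom_ideal.zero dom_ideal_diff lie_ideal.zero lie_ideal_diff FA_diff beta_sum_FA
        beta_sum_dom_ideal beta_sum_inj simp: beta_sum_diff)

end
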